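(* Let $a=[S,N]$ be an internal edge of the triangular mesh $\mathcal{T}$, with the neighbouring triangles $K,L,M,P,Q,R$ and vertices $W,E,A,B,C,D$ described in the context, and let $\varphi^\star_{SN}$ be a dual Raviart-Thomas basis function satisfying the Dual Basis Hypothesis of the context. Introduce the fluxes $$\eta=\int_{SN}\varphi^\star_{SN}\cdot n_{SN}\,ds,\quad \alpha=\int_{EN}\varphi^\star_{SN}\cdot n_{EN}\,ds,\quad \beta=\int_{NW}\varphi^\star_{SN}\cdot n_{NW}\,ds,$$ $$\gamma=\int_{WS}\varphi^\star_{SN}\cdot n_{WS}\,ds,\quad \delta=\int_{SE}\varphi^\star_{SN}\cdot n_{SE}\,ds .$$ Then the following conditions necessarily hold: $$\eta\,\overrightarrow{g_Kg_L}+\alpha\,\overrightarrow{g_Lg_M}+\beta\,\overrightarrow{g_Kg_P}+\gamma\,\overrightarrow{g_Kg_Q}+\delta\,\overrightarrow{g_Lg_R}=|\overrightarrow{SN}|\,n_{SN}$$ and $$\alpha\,\overrightarrow{g_Lg_M}\cdot\overrightarrow{WA}+\beta\,\overrightarrow{g_Kg_P}\cdot\overrightarrow{EB}+\gamma\,\overrightarrow{g_Kg_Q}\cdot\overrightarrow{EC}+\delta\,\overrightarrow{g_Lg_R}\cdot\overrightarrow{WD}=-3\,|\overrightarrow{SN}|\;n_{SN}\cdot\bigl(\overrightarrow{Og_L}+\overrightarrow{Og_K}\bigr),$$ where $O$ is the midpoint of $[S,N]$.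
   Context: $\mathcal{T}$ is a triangular mesh (two-dimensional cellular complex made of triangles, straight edges and vertices) of a bounded convex polygonal domain $\Omega\subset\mathbb{R}^2$, with set of edges $\mathcal{A}_{\mathcal{T}}$. $(\cdot,\cdot)$ is the $L^2(\Omega)$ scalar product; $H(\mathrm{div},\Omega)=\{q\in L^2(\Omega)^2:\mathrm{div}\,q\in L^2(\Omega)\}$. $g_T$ denotes the barycenter of a triangle $T$. For an oriented edge $XY$, $n_{XY}$ is the unit normal such that the pair $(n_{XY},\overrightarrow{XY})$ is direct (positively oriented). Raviart-Thomas functions: for an edge $b$ with a chosen unit normal $n_b$, shared by a triangle $T_1$ (opposite vertex $W_1$) and a triangle $T_2$ (opposite vertex $E_2$) with $n_b$ pointing from $T_1$ to $T_2$, $\varphi_b(x)=\frac{1}{2|T_1|}(x-W_1)$ on $T_1$, $-\frac{1}{2|T_2|}(x-E_2)$ on $T_2$, $0$ elsewhere (if $b\subset\partial\Omega$, $n_b$ points out of $\Omega$ and $T_2$ is absent). For $a=[S,N]$, $n_a=n_{SN}$. Neighbouring triangles of an internal edge $a=[S,N]$: $a$ is shared by $K=(S,N,W)$ and $L=(N,S,E)$, with $n_{SN}$ pointing from $K$ to $L$. Four new triangles $M,P,Q,R$ and four new vertices $A,B,C,D$ of the mesh are defined by: the edge $EN$ is shared by $L$ and $M=(N,E,A)$; $NW$ is shared by $K$ and $P=(W,N,B)$; $WS$ is shared by $K$ and $Q=(S,W,C)$; $SE$ is shared by $L$ and $R=(E,S,D)$. Thus $n_{EN},n_{SE}$ point out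 of $L$ and $n_{NW},n_{WS}$ point out of $K$. Dual Basis Hypothesis on the family $(\varphi^\star_b)_{b\in\mathcal{A}_{\mathcal{T}}}$: (i) $\varphi^\star_b\in H(\mathrm{div},\Omega)$ for all $b$; (ii) $(\varphi_a,\varphi^\star_b)=\delta_{a,b}$ (Kronecker symbol) for all $a,b\in\mathcal{A}_{\mathcal{T}}$; (iii) for each internal edge $a=[S,N]$, the support of $\varphi^\star_a=\varphi^\star_{SN}$ is contained in $K\cup L\cup M\cup P\cup Q\cup R$; (iv) $\mathrm{div}\,\varphi^\star_a$ is constant in each triangle of $\mathcal{T}$, for all $a\in\mathcal{A}_{\mathcal{T}}$.
   Formalization: The normal traces of φ*_SN are assumed integrable on the edges, so that the fluxes exist, and φ*_SN·n is assumed to vanish on any edge of M, P, Q, R lying on ∂Ω; without this the identities can fail. *)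

theory Defs
  imports "HOL-Analysis.Analysis"
begin

section \<open>Triangular meshes of a convex polygonal domain\<close>

definition convex_polygonal_domain :: "(real^2) set \<Rightarrow> bool" where
  "convex_polygonal_domain \<Omega> \<longleftrightarrow>
     open \<Omega> \<and> \<Omega> \<noteq> {} \<and> convex \<Omega> \<and> bounded \<Omega> \<and> polytope (closure \<Omega>)"

text \<open>The triangles are closed, so they tile the closure of the domain.
  The constant \<^const>\<open>triangulation\<close> provides conformity: two triangles meet along a common face.\<close>

definition triangular_mesh :: "(real^2) set \<Rightarrow> (real^2) set set \<Rightarrow> bool" where
  "triangular_mesh \<Omega> \<T> \<longleftrightarrow>
     triangulation \<T> \<and> (\<forall>T\<in>\<T>. 2 simplex T) \<and> \<Union>\<T> = closure \<Omega>"

definition mesh_edges :: "(real^2) set set \<Rightarrow> (real^2) set set" where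
  "mesh_edges \<T> = {e. \<exists>T\<in>\<T>. e edge_of T}"

definition barycentre :: "real^2 \<Rightarrow> real^2 \<Rightarrow> real^2 \<Rightarrow> real^2" where
  "barycentre X Y Z = (1/3) *\<^sub>R (X + Y + Z)"

text \<open>\<open>edge_normal X Y\<close> is the vector \<open>Y - X\<close>, normalised and rotated by a quarter turn
  clockwise, so that the pair (\<open>edge_normal X Y\<close>, \<open>Y - X\<close>) is direct.\<close>

definition edge_normal :: "real^2 \<Rightarrow> real^2 \<Rightarrow> real^2" where
  "edge_normal X Y = (1 / dist X Y) *\<^sub>R vector [(Y - X) $ 2, - ((Y - X) $ 1)]"

text \<open>For a convex set \<open>C\<close> having the segment \<open>e\<close> on its boundary: the normal \<open>n\<close> of \<open>e\<close> points
  out of \<open>C\<close>.\<close>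

definition points_out :: "(real^2) set \<Rightarrow> (real^2) set \<Rightarrow> real^2 \<Rightarrow> bool" where
  "points_out C e n \<longleftrightarrow> (\<forall>w\<in>C. \<forall>x\<in>e. n \<bullet> (w - x) \<le> 0)"

definition edge_orientation ::
    "(real^2) set \<Rightarrow> (real^2) set set \<Rightarrow> ((real^2) set \<Rightarrow> real^2) \<Rightarrow> bool" where
  "edge_orientation \<Omega> \<T> \<nu> \<longleftrightarrow>
     (\<forall>b\<in>mesh_edges \<T>.
        norm (\<nu> b) = 1 \<and> (\<forall>x\<in>b. \<forall>y\<in>b. \<nu> b \<bullet> (x - y) = 0) \<and>
        (b \<subseteq> frontier \<Omega> \<longrightarrow> points_out \<Omega> b (\<nu> b)))"

text \<open>The neighbourhood of an internal edge \<open>[S,N]\<close>: the triangles are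
  \<open>K = SNW\<close>, \<open>L = NSE\<close>, \<open>M = NEA\<close>, \<open>P = WNB\<close>, \<open>Q = SWC\<close>, \<open>R = ESD\<close>.
  Distinctness renders that \<open>A\<close>, \<open>B\<close>, \<open>C\<close>, \<open>D\<close> are four new vertices (and \<open>M\<close>, \<open>P\<close>, \<open>Q\<close>, \<open>R\<close> four
  new triangles).  The last two lines say that the normal of the oriented edge \<open>SN\<close> points from
  \<open>K\<close> to \<open>L\<close>; then all six triples above are listed counterclockwise.\<close>

definition edge_neighbourhood ::
    "(real^2) set set \<Rightarrow> real^2 \<Rightarrow> real^2 \<Rightarrow> real^2 \<Rightarrow> real^2 \<Rightarrow>
     real^2 \<Rightarrow> real^2 \<Rightarrow> real^2 \<Rightarrow> real^2 \<Rightarrow> bool" where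
  "edge_neighbourhood \<T> S N W E A B C D \<longleftrightarrow>
     distinct [S, N, W, E, A, B, C, D] \<and>
     convex hull {S, N, W} \<in> \<T> \<and> convex hull {N, S, E} \<in> \<T> \<and>
     convex hull {N, E, A} \<in> \<T> \<and> convex hull {W, N, B} \<in> \<T> \<and>
     convex hull {S, W, C} \<in> \<T> \<and> convex hull {E, S, D} \<in> \<T> \<and>
     points_out (convex hull {S, N, W}) (closed_segment S N) (edge_normal S N) \<and>
     points_out (convex hull {N, S, E}) (closed_segment S N) (- edge_normal S N)"

section \<open>Raviart-Thomas functions\<close>

definition opposite_vertex :: "(real^2) set \<Rightarrow> (real^2) set \<Rightarrow> real^2" where
  "opposite_vertex T b = (THE V. V extreme_point_of T \<and> V \<notin> b)"

text \<open>The function is set to zero on the edges themselves, a null set on which the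
  two-sided values need not agree; this does not matter for \<open>L\<^sup>2\<close> scalar products.\<close>

definition raviart_thomas ::
    "(real^2) set set \<Rightarrow> ((real^2) set \<Rightarrow> real^2) \<Rightarrow> (real^2) set \<Rightarrow> real^2 \<Rightarrow> real^2" where
  "raviart_thomas \<T> \<nu> b x =
     (\<Sum>T | T \<in> \<T> \<and> b edge_of T \<and> x \<in> interior T.
        ((if points_out T b (\<nu> b) then 1 else - 1) / (2 * measure lebesgue T)) *\<^sub>R
          (x - opposite_vertex T b))"

section \<open>The space H(div)\<close>

definition L2_on :: "(real^2) set \<Rightarrow> (real^2 \<Rightarrow> 'b::euclidean_space) \<Rightarrow> bool" where
  "L2_on \<Omega> f \<longleftrightarrow>
     f \<in> borel_measurable (lebesgue_on \<Omega>) \<and> integrable (lebesgue_on \<Omega>) (\<lambda>x. (norm (f x))\<^sup>2)"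

definition L2_inner ::
    "(real^2) set \<Rightarrow> (real^2 \<Rightarrow> real^2) \<Rightarrow> (real^2 \<Rightarrow> real^2) \<Rightarrow> real" where
  "L2_inner \<Omega> f g = (LINT x:\<Omega>|lebesgue. f x \<bullet> g x)"

definition C1_with_gradient :: "(real^2 \<Rightarrow> real) \<Rightarrow> (real^2 \<Rightarrow> real^2) \<Rightarrow> bool" where
  "C1_with_gradient v G \<longleftrightarrow> (\<forall>x. GDERIV v x :> G x) \<and> continuous_on UNIV G"

definition has_weak_divergence ::
    "(real^2) set \<Rightarrow> (real^2 \<Rightarrow> real^2) \<Rightarrow> (real^2 \<Rightarrow> real) \<Rightarrow> bool" where
  "has_weak_divergence \<Omega> q d \<longleftrightarrow>
     (\<forall>v G. C1_with_gradient v G \<and>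
            compact (closure {x. v x \<noteq> 0}) \<and> closure {x. v x \<noteq> 0} \<subseteq> \<Omega> \<longrightarrow>
        (LINT x:\<Omega>|lebesgue. q x \<bullet> G x) = - (LINT x:\<Omega>|lebesgue. d x * v x))"

definition Hdiv :: "(real^2) set \<Rightarrow> (real^2 \<Rightarrow> real^2) set" where
  "Hdiv \<Omega> = {q. L2_on \<Omega> q \<and> (\<exists>d. L2_on \<Omega> d \<and> has_weak_divergence \<Omega> q d)}"

text \<open>A representative of the weak divergence, which is unique up to null sets.\<close>

definition divergence :: "(real^2) set \<Rightarrow> (real^2 \<Rightarrow> real^2) \<Rightarrow> real^2 \<Rightarrow> real" where
  "divergence \<Omega> q = (SOME d. L2_on \<Omega> d \<and> has_weak_divergence \<Omega> q d)"

section \<open>Normal traces and fluxes\<close>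

text \<open>The integral over the segment \<open>[X,Y]\<close> with respect to arc length.\<close>

definition edge_integral :: "real^2 \<Rightarrow> real^2 \<Rightarrow> (real^2 \<Rightarrow> real) \<Rightarrow> real" where
  "edge_integral X Y f = dist X Y * (LINT t:{0..1}|lebesgue. f (linepath X Y t))"

definition edge_integrable :: "real^2 \<Rightarrow> real^2 \<Rightarrow> (real^2 \<Rightarrow> real) \<Rightarrow> bool" where
  "edge_integrable X Y f \<longleftrightarrow> set_integrable lebesgue {0..1} (\<lambda>t. f (linepath X Y t))"

text \<open>The outward normal trace of a field \<open>q\<close> of H(div) on the boundary of a triangle is the
  functional given by Green's formula.  For a general \<open>q\<close> it is only a distribution of order
  \<open>-1/2\<close>, which has no integral over a single edge.  The predicate below says that, on each
  triangle \<open>T\<close>, it is represented by the function \<open>g T\<close>, integrable on each edge of \<open>T\<close>, so that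
  fluxes through edges make sense.  On the edge \<open>[X,Y]\<close> of a triangle
  \<open>T = XYZ\<close> listed counterclockwise, \<open>g T\<close> is the trace of \<open>q \<bullet> edge_normal X Y\<close>.\<close>

definition has_normal_traces ::
    "(real^2) set \<Rightarrow> (real^2) set set \<Rightarrow> (real^2 \<Rightarrow> real^2) \<Rightarrow>
     ((real^2) set \<Rightarrow> real^2 \<Rightarrow> real) \<Rightarrow> bool" where
  "has_normal_traces \<Omega> \<T> q g \<longleftrightarrow>
     (\<forall>T\<in>\<T>. \<forall>X Y Z. T = convex hull {X, Y, Z} \<longrightarrow>
        edge_integrable X Y (g T) \<and> edge_integrable Y Z (g T) \<and> edge_integrable Z X (g T) \<and>
        (\<forall>v G. C1_with_gradient v G \<longrightarrow>
           (LINT x:T|lebesgue. q x \<bullet> G x + divergence \<Omega> q x * v x) =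
             edge_integral X Y (\<lambda>x. g T x * v x) +
             edge_integral Y Z (\<lambda>x. g T x * v x) +
             edge_integral Z X (\<lambda>x. g T x * v x)))"

section \<open>The dual basis hypothesis\<close>

text \<open>Fields are classes modulo null sets, hence the essential support in the third clause.\<close>

definition dual_basis_hypothesis ::
    "(real^2) set \<Rightarrow> (real^2) set set \<Rightarrow> ((real^2) set \<Rightarrow> real^2) \<Rightarrow>
     ((real^2) set \<Rightarrow> real^2 \<Rightarrow> real^2) \<Rightarrow> bool" where
  "dual_basis_hypothesis \<Omega> \<T> \<nu> \<phi>s \<longleftrightarrow>
     (\<forall>b\<in>mesh_edges \<T>. \<phi>s b \<in> Hdiv \<Omega>) \<and>
     (\<forall>a\<in>mesh_edges \<T>. \<forall>b\<in>mesh_edges \<T>.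
        L2_inner \<Omega> (raviart_thomas \<T> \<nu> a) (\<phi>s b) = (if a = b then 1 else 0)) \<and>
     (\<forall>S N W E A B C D. edge_neighbourhood \<T> S N W E A B C D \<longrightarrow>
        (AE x in lebesgue. x \<in> \<Omega> \<longrightarrow>
           x \<notin> convex hull {S, N, W} \<union> convex hull {N, S, E} \<union> convex hull {N, E, A} \<union>
               convex hull {W, N, B} \<union> convex hull {S, W, C} \<union> convex hull {E, S, D} \<longrightarrow>
           \<phi>s (closed_segment S N) x = 0)) \<and>
     (\<forall>a\<in>mesh_edges \<T>. \<forall>T\<in>\<T>. \<exists>c. AE x in lebesgue. x \<in> T \<longrightarrow> divergence \<Omega> (\<phi>s a) x = c)"

end

theory Submission
  imports Defs
begin

text \<open>The identities come from testing the duality relations with the two kinds of affine fields that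
  Raviart-Thomas functions reproduce exactly: a constant \<open>u\<close> and \<open>x - O\<close>.  Such a field \<open>F\<close> is the sum of
  the \<open>\<phi>\<^sub>b\<close> weighted by its fluxes through the edges \<open>b\<close>, so its scalar product with the dual function of
  \<open>[S,N]\<close> is the flux of \<open>F\<close> through \<open>[S,N]\<close>.  On the other hand \<open>F\<close> is the gradient of \<open>v = u \<bullet> x\<close> or
  \<open>v = \<bar>x - O\<bar>\<^sup>2/2\<close>.  Integrating by parts on the six triangles, the boundary terms cancel, because the two
  traces on an inner edge are opposite and those on the outer edges vanish; what remains is minus the sum over
  the triangles of the constant divergence times the integral of \<open>v\<close>.  With \<open>v = 1\<close> the divergences are
  expressed through the fluxes, and the integrals of \<open>v\<close> are moments of triangles.\<close>

section \<open>Triangles in barycentric coordinates\<close>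

text \<open>A field of H(div) has no pointwise values on an edge: its traces are given only through
  Green's formula, separately on each triangle. That the traces from the two sides cancel is
  therefore not among the hypotheses and has to be extracted from the weak divergence, whose test
  functions must have compact support in the open domain; products of cut-off barycentric
  coordinates provide them. On an edge leading out of the support the same balance is applied with
  the trace 0 on the far side. This requires the divergence, a chosen representative known only to
  be constant there, to vanish, which a bubble function shows. The point \<open>O\<close> is a good
  centre because \<open>x - O\<close> is tangential along \<open>[S,N]\<close>: its flux there is
  zero, so the second test gives a homogeneous relation. That relation still contains \<eta>; the
  first identity, multiplied by the vector \<open>E + W - 2 O\<close>, removes it and produces the
  right-hand side.\<close>

definition orient :: "real^2 \<Rightarrow> real^2 \<Rightarrow> real^2 \<Rightarrow> real" where
  "orient X Y Z = (Y$1 - X$1) * (Z$2 - X$2) - (Y$2 - X$2) * (Z$1 - X$1)"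

text \<open>\<open>orient\<close> is twice the signed area, positive for a counterclockwise triple.
  The ratio is the barycentric coordinate of the first vertex; rotating the arguments gives the
  other two, and the value does not depend on how the triangle is oriented.\<close>

definition bary :: "real^2 \<Rightarrow> real^2 \<Rightarrow> real^2 \<Rightarrow> real^2 \<Rightarrow> real" where
  "bary X Y Z x = orient x Y Z / orient X Y Z"

lemma orient_rotate: "orient Y Z X = orient X Y Z"
  by (simp add: orient_def algebra_simps)

lemma orient_swap: "orient Y X Z = - orient X Y Z"
  by (simp add: orient_def algebra_simps)

lemma orient_eq_0 [simp]: "orient X X Z = 0" "orient X Y X = 0" "orient X Y Y = 0"
  by (simp_all add: orient_def algebra_simps)

lemma orient_affine:
  "orient ((1 - t) *\<^sub>R x + t *\<^sub>R y) Y Z = (1 - t) * orient x Y Z + t * orient y Y Z"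
  by (simp add: orient_def algebra_simps)

lemma orient_add_scaleR:
  "orient (x + t *\<^sub>R (V - U)) Y Z = orient x Y Z + t * (orient V Y Z - orient U Y Z)"
  by (simp add: orient_def algebra_simps)

lemma bary_affine:
  "bary X Y Z ((1 - t) *\<^sub>R x + t *\<^sub>R y) = (1 - t) * bary X Y Z x + t * bary X Y Z y"
  by (simp add: bary_def orient_affine add_divide_distrib)

lemma bary_add_scaleR:
  "bary X Y Z (x + t *\<^sub>R (V - U)) = bary X Y Z x + t * (bary X Y Z V - bary X Y Z U)"
  unfolding bary_def orient_add_scaleR by (simp add: add_divide_distrib diff_divide_distrib right_diff_distrib)

lemma bary_vertex [simp]:
  "orient X Y Z \<noteq> 0 \<Longrightarrow> bary X Y Z X = 1" "bary X Y Z Y = 0" "bary X Y Z Z = 0"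
  by (simp_all add: bary_def orient_def)

lemma bary_sum:
  assumes "orient X Y Z \<noteq> 0"
  shows "bary X Y Z x + bary Y Z X x + bary Z X Y x = 1"
proof -
  have "orient x Y Z + orient x Z X + orient x X Y = orient X Y Z"
    by (simp add: orient_def algebra_simps)
  then show ?thesis
    using assms orient_rotate[of Y Z X] orient_rotate[of X Y Z]
    by (simp add: bary_def flip: add_divide_distrib)
qed

lemma bary_combination:
  assumes "orient X Y Z \<noteq> 0"
  shows "bary X Y Z x *\<^sub>R X + bary Y Z X x *\<^sub>R Y + bary Z X Y x *\<^sub>R Z = x"
proof -
  have "(orient x Y Z * X$i + orient x Z X * Y$i + orient x X Y * Z$i) = orient X Y Z * x$i"
    if "i = 1 \<or> i = 2" for i
    using that by (auto simp add: orient_def algebra_simps)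
  then show ?thesis
    using assms orient_rotate[of Y Z X] orient_rotate[of X Y Z]
    by (simp add: bary_def vec_eq_iff forall_2 flip: add_divide_distrib)
qed

lemma continuous_on_bary [continuous_intros]: "continuous_on A (bary X Y Z)"
  unfolding bary_def orient_def divide_inverse by (intro continuous_intros)

lemma mem_triangle_iff:
  assumes "orient X Y Z \<noteq> 0"
  shows "x \<in> convex hull {X, Y, Z} \<longleftrightarrow> 0 \<le> bary X Y Z x \<and> 0 \<le> bary Y Z X x \<and> 0 \<le> bary Z X Y x"
proof
  assume "x \<in> convex hull {X, Y, Z}"
  then obtain u v w where uvw: "0 \<le> u" "0 \<le> v" "0 \<le> w" "u + v + w = 1"
    "x = u *\<^sub>R X + v *\<^sub>R Y + w *\<^sub>R Z"
    unfolding convex_hull_3 by blast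
  have u: "u = 1 - v - w" using uvw by simp
  have "bary X Y Z x = u" "bary Y Z X x = v" "bary Z X Y x = w"
    using assms orient_rotate[of Y Z X] orient_rotate[of X Y Z]
    unfolding bary_def uvw(5) u by (simp_all add: field_simps) (simp_all add: orient_def algebra_simps)
  then show "0 \<le> bary X Y Z x \<and> 0 \<le> bary Y Z X x \<and> 0 \<le> bary Z X Y x"
    using uvw by simp
next
  assume "0 \<le> bary X Y Z x \<and> 0 \<le> bary Y Z X x \<and> 0 \<le> bary Z X Y x"
  then show "x \<in> convex hull {X, Y, Z}"
    unfolding convex_hull_3 using bary_sum[OF assms, of x] bary_combination[OF assms, of x]
    by (metis (mono_tags, lifting) mem_Collect_eq)
qed

lemma mem_interior_triangle:
  assumes "orient X Y Z \<noteq> 0" "0 < bary X Y Z x" "0 < bary Y Z X x" "0 < bary Z X Y x"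
  shows "x \<in> interior (convex hull {X, Y, Z})"
proof -
  let ?U = "{x. 0 < bary X Y Z x} \<inter> {x. 0 < bary Y Z X x} \<inter> {x. 0 < bary Z X Y x}"
  have "open ?U"
    by (intro open_Int open_Collect_less) (rule continuous_on_bary continuous_on_const)+
  moreover have "?U \<subseteq> convex hull {X, Y, Z}"
    using mem_triangle_iff[OF assms(1)] less_imp_le by blast
  ultimately show ?thesis
    using assms by (intro interiorI[of ?U]) auto
qed

lemma measure_triangle: "measure lebesgue (convex hull {X, Y, Z}) = \<bar>orient X Y Z\<bar> / 2"
proof -
  have "measure lebesgue (convex hull {X, Y, Z}) = measure lborel (convex hull {X, Y, Z})"
    by (simp add: borel_compact finite_imp_compact_convex_hull)
  then show ?thesis
    unfolding content_triangle orient_def by (simp add: abs_minus_commute mult.commute)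
qed

lemma not_affine_dependent_triangle:
  assumes "orient X Y Z \<noteq> 0"
  shows "\<not> affine_dependent {X, Y, Z}"
proof
  assume "affine_dependent {X, Y, Z}"
  then have "collinear {X, Y, Z}"
    by (rule affine_dependent_imp_collinear_3)
  then have "collinear {0, X - Y, Z - Y}"
    by (simp add: collinear_3)
  then consider "X = Y" | "Z = Y" | c where "Z - Y = c *\<^sub>R (X - Y)"
    unfolding collinear_lemma by auto
  then show False
  proof cases
    case 3
    then have "Z = Y + c *\<^sub>R (X - Y)" by (simp add: algebra_simps)
    then have "orient X Y Z = orient X Y (Y + c *\<^sub>R (X - Y))" by metis
    then have "orient X Y Z = 0" by (simp add: orient_def algebra_simps)
    then show ?thesis using assms by simp
  qed (use assms in auto)
qed

text \<open>A convex set of area zero has empty interior, which is incompatible with affine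
  dimension 2. Swapping two vertices then makes the orientation positive.\<close>

lemma simplex_triangleE:
  assumes "2 simplex T"
  obtains X Y Z where "T = convex hull {X, Y, Z}" "0 < orient X Y Z"
proof -
  obtain C where C: "\<not> affine_dependent C" "card C = 3" "T = convex hull C"
    using assms unfolding simplex_def by auto
  then obtain X Y Z where XYZ: "C = {X, Y, Z}" "X \<noteq> Y" "Y \<noteq> Z" "X \<noteq> Z"
    by (metis card_3_iff)
  have "orient X Y Z \<noteq> 0"
  proof
    assume "orient X Y Z = 0"
    then have "measure lebesgue T = 0"
      by (simp add: C XYZ measure_triangle)
    moreover have "bounded T" "convex T"
      by (simp_all add: C XYZ bounded_convex_hull convex_convex_hull)
    ultimately have "negligible T"
      by (simp add: measurable_convex negligible_iff_measure)
    then have "interior T = {}"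
      using \<open>convex T\<close> negligible_convex_interior by blast
    moreover have "aff_dim T = 2"
      using C aff_dim_affine_independent[of C] by (simp add: aff_dim_convex_hull)
    ultimately show False
      using rel_interior_interior[of T] \<open>convex T\<close> rel_interior_eq_empty[of T] aff_dim_eq_full[of T]
      by auto
  qed
  then consider "0 < orient X Y Z" | "0 < orient Y X Z"
    using orient_swap[of X Y Z] by linarith
  then show thesis
  proof cases
    case 1
    then show thesis using that C XYZ by blast
  next
    case 2
    then show thesis using that[of Y X Z] C XYZ by (simp add: insert_commute)
  qed
qed

lemma triangle_vertices_unique:
  assumes "convex hull {X, Y, Z} = convex hull {X', Y', Z'}"
    and "orient X Y Z \<noteq> 0" "orient X' Y' Z' \<noteq> 0"
  shows "{X, Y, Z} = {X', Y', Z'}"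
  using assms extreme_point_of_convex_hull_affine_independent not_affine_dependent_triangle
  by (metis subsetI subset_antisym)

text \<open>The area depends only on the hull, so a listing of its points that is not known to be
  independent can be compared with a counterclockwise one.\<close>

lemma orient_nonzero_simplex:
  assumes "2 simplex (convex hull {X, Y, Z})"
  shows "orient X Y Z \<noteq> 0"
proof
  assume "orient X Y Z = 0"
  moreover obtain X' Y' Z' where "convex hull {X, Y, Z} = convex hull {X', Y', Z'}" "0 < orient X' Y' Z'"
    using assms simplex_triangleE by blast
  ultimately show False
    using measure_triangle[of X Y Z] measure_triangle[of X' Y' Z'] by simp
qed

text \<open>Faces of a simplex are the hulls of subsets of its vertices, and affine dimension 1
  selects the subsets with two elements.\<close>

lemma edges_of_triangle:
  assumes "orient X Y Z \<noteq> 0"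
  shows "b edge_of convex hull {X, Y, Z} \<longleftrightarrow>
    b = closed_segment X Y \<or> b = closed_segment Y Z \<or> b = closed_segment Z X"
proof -
  note indep = not_affine_dependent_triangle[OF assms]
  have ne: "X \<noteq> Y" "Y \<noteq> Z" "Z \<noteq> X" using assms by auto
  have card: "card c = 2 \<longleftrightarrow> c \<in> {{X,Y}, {Y,Z}, {Z,X}}" if "c \<subseteq> {X, Y, Z}" for c
  proof
    assume "card c = 2"
    then obtain a b where "c = {a, b}" "a \<noteq> b"
      by (meson card_2_iff)
    moreover have "a = X \<or> a = Y \<or> a = Z" "b = X \<or> b = Y \<or> b = Z"
      using that calculation by blast+
    ultimately show "c \<in> {{X,Y}, {Y,Z}, {Z,X}}"
      by (elim disjE) (simp_all add: doubleton_eq_iff)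
  qed (use ne in auto)
  have dim: "aff_dim (convex hull c) = int (card c) - 1" if "c \<subseteq> {X, Y, Z}" for c
    using that aff_dim_affine_independent[of c] affine_independent_subset[OF indep] by (simp add: aff_dim_convex_hull)
  have "b edge_of convex hull {X, Y, Z} \<longleftrightarrow> (\<exists>c. c \<subseteq> {X,Y,Z} \<and> b = convex hull c \<and> card c = 2)"
    (is "_ \<longleftrightarrow> ?R")
  proof
    assume "b edge_of convex hull {X, Y, Z}"
    then obtain c where c: "c \<subseteq> {X, Y, Z}" "b = convex hull c" "aff_dim b = 1"
      unfolding edge_of_def face_of_convex_hull_affine_independent[OF indep] by blast
    then show ?R using dim[OF c(1)] by auto
  next
    assume ?R
    then obtain c where c: "c \<subseteq> {X, Y, Z}" "b = convex hull c" "card c = 2" by blast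
    then show "b edge_of convex hull {X, Y, Z}"
      unfolding edge_of_def face_of_convex_hull_affine_independent[OF indep] using dim[OF c(1)] by auto
  qed
  also have "\<dots> \<longleftrightarrow> (\<exists>c\<in>{{X,Y}, {Y,Z}, {Z,X}}. b = convex hull c)"
  proof
    assume "\<exists>c\<in>{{X,Y}, {Y,Z}, {Z,X}}. b = convex hull c"
    then obtain c where "c \<in> {{X,Y}, {Y,Z}, {Z,X}}" "b = convex hull c" by blast
    moreover from this have "c \<subseteq> {X, Y, Z}" by auto
    ultimately show "\<exists>c. c \<subseteq> {X,Y,Z} \<and> b = convex hull c \<and> card c = 2"
      using card by blast
  qed (use card in blast)
  finally show ?thesis
    by (simp add: segment_convex_hull)
qed

section \<open>First and second moments of a triangle\<close>

lemma compact_triangle [simp]: "compact (convex hull {X, Y, Z :: 'a::euclidean_space})"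
  by (simp add: finite_imp_compact_convex_hull)

lemma absolutely_integrable_continuous_compact:
  fixes f :: "'a::euclidean_space \<Rightarrow> 'b::euclidean_space"
  assumes "compact T" "continuous_on T f"
  shows "f absolutely_integrable_on T"
  using borel_integrable_compact[OF assms] assms
  by (metis absolutely_integrable_measurable borel_compact integrable_completion
      borel_measurable_integrable set_integrable_def sets_completionI_sets sets_lborel
      integrable_restrict_space)

text \<open>The Jacobian in the plane is the square of the ratio, whatever its sign; the negative
  ratio serves for the middle triangle of the subdivision below.\<close>

lemma integral_homothety:
  fixes f :: "real^2 \<Rightarrow> real"
  assumes "compact T" "continuous_on UNIV f" "r \<noteq> 0"
  shows "integral ((\<lambda>x. b + r *\<^sub>R x) ` T) f = r\<^sup>2 * integral T (\<lambda>x. f (b + r *\<^sub>R x))"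
proof -
  let ?g = "\<lambda>x. b + r *\<^sub>R x"
  have inj: "?g x \<in> ?g ` T \<longleftrightarrow> x \<in> T" for x
    using assms(3) by auto
  have cg: "compact (?g ` T)"
    by (intro compact_continuous_image continuous_intros assms(1))
  have cf: "continuous_on A f" for A
    using assms(2) continuous_on_subset by blast
  have cfg: "continuous_on A (\<lambda>x. f (?g x))" for A
    by (intro continuous_on_compose2[OF assms(2)] continuous_intros) auto
  have meas: "(\<lambda>x. indicator (?g ` T) x *\<^sub>R f x) \<in> borel_measurable borel"
    using cg by (intro borel_measurable_scaleR
      borel_measurable_indicator borel_measurable_continuous_onI cf) (auto simp: borel_compact)
  have "integral (?g ` T) f = (LINT x:?g ` T|lborel. f x)"
    using borel_integrable_compact[OF cg cf]
    by (simp add: set_borel_integral_eq_integral set_integrable_def)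
  also have "\<dots> = (\<integral>x. indicator (?g ` T) x *\<^sub>R f x
      \<partial>density (distr lborel borel ?g) (\<lambda>_. ennreal (\<bar>r\<bar> ^ DIM(real^2))))"
    unfolding set_lebesgue_integral_def using lborel_affine[OF assms(3), of b] by simp
  also have "\<dots> = r\<^sup>2 * (\<integral>x. indicator (?g ` T) (?g x) *\<^sub>R f (?g x) \<partial>lborel)"
    using meas by (subst integral_density) (auto simp: integral_distr)
  also have "\<dots> = r\<^sup>2 * (LINT x:T|lborel. f (?g x))"
    unfolding set_lebesgue_integral_def by (simp add: indicator_def inj)
  also have "(LINT x:T|lborel. f (?g x)) = integral T (\<lambda>x. f (?g x))"
    using borel_integrable_compact[OF assms(1) cfg]
    by (simp add: set_borel_integral_eq_integral set_integrable_def)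
  finally show ?thesis .
qed

lemma bary_eq_inner:
  obtains n c where "\<And>x. bary X Y Z x = c + n \<bullet> x"
proof
  show "bary X Y Z x = orient 0 Y Z / orient X Y Z +
      ((1 / orient X Y Z) *\<^sub>R vector [Y$2 - Z$2, Z$1 - Y$1]) \<bullet> x" for x
    unfolding bary_def inner_scaleR_left
    by (simp add: orient_def inner_vec_def sum_2 algebra_simps flip: add_divide_distrib diff_divide_distrib)
qed

lemma negligible_bary_eq:
  assumes "orient X Y Z \<noteq> 0"
  shows "negligible {x. bary X Y Z x = c}"
proof -
  obtain n e where n: "\<And>x. bary X Y Z x = e + n \<bullet> x"
    using bary_eq_inner by blast
  have "n \<noteq> 0"
    using n[of X] n[of Y] assms by auto
  moreover have "bary X Y Z x = c \<longleftrightarrow> n \<bullet> x = c - e" for x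
    unfolding n by auto
  ultimately show ?thesis
    using negligible_hyperplane[of n] by simp
qed

lemma bary_midpoint_image:
  assumes "orient X Y Z \<noteq> 0"
  shows "bary X Y Z ((1/2) *\<^sub>R V + (1/2) *\<^sub>R x) = (bary X Y Z V + bary X Y Z x) / 2"
  using bary_affine[of X Y Z "1/2" V x] by simp

text \<open>The homothety of ratio 1/2 centred at \<open>X\<close> sends the coordinate
  \<open>s\<close> of \<open>X\<close> to \<open>(1 + s) / 2\<close> and halves the other
  two.\<close>

lemma corner_triangle:
  assumes "orient X Y Z \<noteq> 0"
  shows "(\<lambda>x. (1/2) *\<^sub>R X + (1/2) *\<^sub>R x) ` (convex hull {X, Y, Z}) =
    {x \<in> convex hull {X, Y, Z}. 1/2 \<le> bary X Y Z x}" (is "?g ` ?T = ?R")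
proof -
  have r: "orient Y Z X \<noteq> 0" "orient Z X Y \<noteq> 0"
    using assms orient_rotate[of Y Z X] orient_rotate[of X Y Z] by auto
  show ?thesis
  proof
    show "?g ` ?T \<subseteq> ?R"
      using assms r by (auto simp: mem_triangle_iff bary_midpoint_image)
    show "?R \<subseteq> ?g ` ?T"
    proof
      fix x assume x: "x \<in> ?R"
      have eq: "x = ?g (2 *\<^sub>R x - X)"
        by (simp add: algebra_simps)
      have "bary X Y Z x = (bary X Y Z X + bary X Y Z (2 *\<^sub>R x - X)) / 2"
        "bary Y Z X x = (bary Y Z X X + bary Y Z X (2 *\<^sub>R x - X)) / 2"
        "bary Z X Y x = (bary Z X Y X + bary Z X Y (2 *\<^sub>R x - X)) / 2"
        using bary_midpoint_image assms r eq by metis+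
      then have "2 *\<^sub>R x - X \<in> ?T"
        using x assms r by (simp add: mem_triangle_iff)
      then show "x \<in> ?g ` ?T"
        using eq by blast
    qed
  qed
qed

text \<open>This map is the homothety of ratio -1/2 centred at the barycentre; it sends every
  barycentric coordinate \<open>s\<close> to \<open>(1 - s) / 2\<close>.\<close>

lemma middle_triangle:
  assumes "orient X Y Z \<noteq> 0"
  shows "(\<lambda>x. (1/2) *\<^sub>R (X + Y + Z) + (-1/2) *\<^sub>R x) ` (convex hull {X, Y, Z}) =
    {x \<in> convex hull {X, Y, Z}. bary X Y Z x \<le> 1/2 \<and> bary Y Z X x \<le> 1/2 \<and> bary Z X Y x \<le> 1/2}"
    (is "?g ` ?T = ?R")
proof -
  have g: "bary X Y Z ((1/2) *\<^sub>R (X + Y + Z) + (-1/2) *\<^sub>R x) = (1 - bary X Y Z x) / 2" if "orient X Y Z \<noteq> 0" for x X Y Z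
  proof -
    have h: "orient ((1/2) *\<^sub>R (X + Y + Z) + (-1/2) *\<^sub>R x) Y Z = (orient X Y Z - orient x Y Z) / 2"
      by (simp add: orient_def algebra_simps)
    then show ?thesis
      using that h by (simp add: bary_def divide_simps)
  qed
  have r: "orient Y Z X \<noteq> 0" "orient Z X Y \<noteq> 0"
    using assms orient_rotate[of Y Z X] orient_rotate[of X Y Z] by auto
  have g1: "bary X Y Z (?g x) = (1 - bary X Y Z x) / 2"
     "bary Y Z X (?g x) = (1 - bary Y Z X x) / 2" "bary Z X Y (?g x) = (1 - bary Z X Y x) / 2" for x
    using g[OF assms] g[OF r(1)] g[OF r(2)] by (simp_all add: add.commute add.left_commute)
  have le1: "bary X Y Z x \<le> 1" "bary Y Z X x \<le> 1" "bary Z X Y x \<le> 1" if "x \<in> ?T" for x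
    using that bary_sum[OF assms, of x] assms by (auto simp: mem_triangle_iff)
  show ?thesis
  proof
    show "?g ` ?T \<subseteq> ?R"
    proof
      fix y assume "y \<in> ?g ` ?T"
      then obtain x where x: "x \<in> ?T" "y = ?g x" by blast
      then show "y \<in> ?R"
        using le1[OF x(1)] unfolding x(2) mem_Collect_eq mem_triangle_iff[OF assms] g1 by simp
    qed
    show "?R \<subseteq> ?g ` ?T"
    proof
      fix x assume x: "x \<in> ?R"
      define y where "y = (X + Y + Z) - 2 *\<^sub>R x"
      have eq: "x = ?g y"
        by (simp add: y_def algebra_simps)
      have "bary X Y Z x = (1 - bary X Y Z y) / 2" "bary Y Z X x = (1 - bary Y Z X y) / 2"
         "bary Z X Y x = (1 - bary Z X Y y) / 2"
        unfolding eq g1 by simp_all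
      then have "y \<in> ?T"
        using x assms by (simp add: mem_triangle_iff)
      then show "x \<in> ?g ` ?T"
        using eq by blast
    qed
  qed
qed

text \<open>The midpoints of the sides cut a triangle into four copies of half the size, each
  contributing with Jacobian 1/4. For a polynomial \<open>f\<close> this self-similarity is a linear
  equation for its integral, so that moments need no change to a reference triangle.\<close>

lemma integral_triangle_subdivide:
  fixes f :: "real^2 \<Rightarrow> real"
  assumes ne: "orient X Y Z \<noteq> 0" and f: "continuous_on UNIV f"
  defines "T \<equiv> convex hull {X, Y, Z}"
  shows "4 * integral T f =
    integral T (\<lambda>x. f ((1/2) *\<^sub>R X + (1/2) *\<^sub>R x)) + integral T (\<lambda>x. f ((1/2) *\<^sub>R Y + (1/2) *\<^sub>R x)) +
    integral T (\<lambda>x. f ((1/2) *\<^sub>R Z + (1/2) *\<^sub>R x)) +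
    integral T (\<lambda>x. f ((1/2) *\<^sub>R (X + Y + Z) + (-1/2) *\<^sub>R x))"
proof -
  have r: "orient Y Z X \<noteq> 0" "orient Z X Y \<noteq> 0"
    using ne orient_rotate[of Y Z X] orient_rotate[of X Y Z] by auto
  have T: "convex hull {Y, Z, X} = T" "convex hull {Z, X, Y} = T"
    by (simp_all add: T_def insert_commute)
  define A B C D where "A = {x \<in> T. 1/2 \<le> bary X Y Z x}" and "B = {x \<in> T. 1/2 \<le> bary Y Z X x}"
    and "C = {x \<in> T. 1/2 \<le> bary Z X Y x}"
    and "D = {x \<in> T. bary X Y Z x \<le> 1/2 \<and> bary Y Z X x \<le> 1/2 \<and> bary Z X Y x \<le> 1/2}"
  note corner = corner_triangle[OF ne, folded T_def, folded A_def]
    corner_triangle[OF r(1), unfolded T, folded B_def]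
    corner_triangle[OF r(2), unfolded T, folded C_def]
    middle_triangle[OF ne, folded T_def, folded D_def]
  have cT: "compact T" by (simp add: T_def)
  have comp: "compact A" "compact B" "compact C" "compact D"
    unfolding corner[symmetric] by (intro compact_continuous_image continuous_intros cT)+
  have int: "(f has_integral integral U f) U" if "compact U" for U
    using absolutely_integrable_continuous_compact[OF that continuous_on_subset[OF f]]
    by (simp add: set_lebesgue_integral_eq_integral(1) integrable_integral)
  let ?l = "\<lambda>X Y Z. {x. bary X Y Z x = 1/2}"
  note negl = negligible_bary_eq[OF ne, of "1/2"] negligible_bary_eq[OF r(1), of "1/2"]
    negligible_bary_eq[OF r(2), of "1/2"]
  note sum = bary_sum[OF ne]
  \<comment> \<open>Coordinates sum to 1, so two of them can be at least 1/2 only if both equal 1/2: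
    all overlaps lie on lines.\<close>
  have "A \<inter> B \<subseteq> ?l X Y Z" "(A \<union> B) \<inter> C \<subseteq> ?l Z X Y"
    "(A \<union> B \<union> C) \<inter> D \<subseteq> ?l X Y Z \<union> ?l Y Z X \<union> ?l Z X Y"
    unfolding A_def B_def C_def D_def T_def mem_triangle_iff[OF ne]
    using sum by (auto simp: not_le) (smt (verit) sum field_sum_of_halves)+
  then have N: "negligible (A \<inter> B)" "negligible ((A \<union> B) \<inter> C)" "negligible ((A \<union> B \<union> C) \<inter> D)"
    using negl by (meson negligible_Un negligible_subset)+
  have "T = A \<union> B \<union> C \<union> D"
    unfolding A_def B_def C_def D_def by auto
  then have "(f has_integral (integral A f + integral B f + integral C f + integral D f)) T"
    using N comp int by (simp add: has_integral_Un)
  then have "integral T f = integral A f + integral B f + integral C f + integral D f"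
    by (rule integral_unique)
  then show ?thesis
    unfolding corner[symmetric] by (simp add: integral_homothety[OF cT f] power2_eq_square del: add_uminus_conv_diff scaleR_minus_left scaleR_minus_right divide_minus_left)
qed

lemma has_integral_const_triangle:
  fixes c :: real
  shows "((\<lambda>x. c) has_integral measure lebesgue (convex hull {X, Y, Z :: real^2}) * c) (convex hull {X, Y, Z})"
  using has_integral_mult_left[OF integrable_integral[OF integrable_on_const[of "convex hull {X, Y, Z}" "1::real"]], of c]
    lmeasure_integral[of "convex hull {X, Y, Z}"]
  by (simp add: lmeasurable_compact)

text \<open>Each corner copy returns half of the unknown integral \<open>J\<close> and the middle
  copy returns minus half of it. The subdivision thus reads \<open>4 * J = J + ...\<close> and can
  be solved for \<open>J\<close>.\<close>

lemma integral_triangle_linear: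
  assumes "orient X Y Z \<noteq> 0"
  shows "integral (convex hull {X, Y, Z}) (\<lambda>x. u \<bullet> x) =
    measure lebesgue (convex hull {X, Y, Z}) * (u \<bullet> barycentre X Y Z)"
proof -
  let ?T = "convex hull {X, Y, Z}"
  let ?m = "measure lebesgue ?T"
  define J where "J = integral ?T (\<lambda>x. u \<bullet> x)"
  have J: "((\<lambda>x. u \<bullet> x) has_integral J) ?T"
    unfolding J_def by (intro integrable_integral set_lebesgue_integral_eq_integral(1)
      absolutely_integrable_continuous_compact continuous_intros compact_triangle)
  have expand: "integral ?T (\<lambda>x. c + d * (u \<bullet> x)) = ?m * c + d * J" for c d
    by (intro integral_unique has_integral_add has_integral_const_triangle has_integral_mult_right J)
  have corner: "integral ?T (\<lambda>x. u \<bullet> ((1/2) *\<^sub>R V + (1/2) *\<^sub>R x)) = ?m * ((u \<bullet> V) / 2) + (1/2) * J" for V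
    using expand[of "(u \<bullet> V) / 2" "1/2"] by (simp add: inner_add_right)
  have middle: "integral ?T (\<lambda>x. u \<bullet> ((1/2) *\<^sub>R V + (-1/2) *\<^sub>R x)) = ?m * ((u \<bullet> V) / 2) + (-1/2) * J" for V
    using expand[of "(u \<bullet> V) / 2" "-1/2"] by (simp add: inner_add_right inner_diff_right)
  have "4 * J = integral ?T (\<lambda>x. u \<bullet> ((1/2) *\<^sub>R X + (1/2) *\<^sub>R x)) +
      integral ?T (\<lambda>x. u \<bullet> ((1/2) *\<^sub>R Y + (1/2) *\<^sub>R x)) +
      integral ?T (\<lambda>x. u \<bullet> ((1/2) *\<^sub>R Z + (1/2) *\<^sub>R x)) +
      integral ?T (\<lambda>x. u \<bullet> ((1/2) *\<^sub>R (X + Y + Z) + (-1/2) *\<^sub>R x))"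
    unfolding J_def by (intro integral_triangle_subdivide[OF assms] continuous_intros)
  also have "\<dots> = J + ?m * (3 * (u \<bullet> barycentre X Y Z))"
    unfolding corner middle by (simp add: barycentre_def inner_add_right field_simps)
  finally show ?thesis by (simp add: J_def)
qed

text \<open>The first moments produced by the three corners cancel against that of the middle copy,
  because \<open>s\<close> is the sum of the vectors \<open>X - p\<close>, \<open>Y - p\<close>,
  \<open>Z - p\<close>. Each of the four copies returns a quarter of \<open>J\<close>; hence
  \<open>3 * J\<close> equals the area times a sum divided by 4, which explains the 12.\<close>

lemma integral_triangle_quadratic:
  assumes "orient X Y Z \<noteq> 0"
  shows "integral (convex hull {X, Y, Z}) (\<lambda>x. (x - p) \<bullet> (x - p)) =
    measure lebesgue (convex hull {X, Y, Z}) *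
      (((X - p) \<bullet> (X - p) + (Y - p) \<bullet> (Y - p) + (Z - p) \<bullet> (Z - p) +
        (X + Y + Z - 3 *\<^sub>R p) \<bullet> (X + Y + Z - 3 *\<^sub>R p)) / 12)"
proof -
  let ?T = "convex hull {X, Y, Z}"
  let ?q = "\<lambda>x. (x - p) \<bullet> (x - p)"
  let ?m = "measure lebesgue ?T"
  define lin where "lin u = integral ?T (\<lambda>x. u \<bullet> (x - p))" for u
  define J where "J = integral ?T ?q"
  have lin: "((\<lambda>x. u \<bullet> (x - p)) has_integral lin u) ?T" and J: "(?q has_integral J) ?T" for u
    unfolding J_def lin_def by (intro integrable_integral set_lebesgue_integral_eq_integral(1)
      absolutely_integrable_continuous_compact continuous_intros compact_triangle)+
  have expand: "integral ?T (\<lambda>x. c + v \<bullet> (x - p) + d * ?q x) = ?m * c + lin v + d * J" for c d v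
    by (intro integral_unique has_integral_add has_integral_const_triangle has_integral_mult_right lin J)
  have lin_add: "lin (u + v) = lin u + lin v" for u v
    using integral_unique[OF has_integral_add[OF lin[of u] lin[of v]]]
    by (simp add: lin_def inner_add_left)
  have lin_scale: "lin (c *\<^sub>R v) = c * lin v" for c v
    by (simp add: lin_def)
  have corner: "integral ?T (\<lambda>x. ?q ((1/2) *\<^sub>R V + (1/2) *\<^sub>R x)) =
      ?m * (?q V / 4) + lin (V - p) / 2 + J / 4" for V
  proof -
    have "?q ((1/2) *\<^sub>R V + (1/2) *\<^sub>R x) = ?q V / 4 + ((1/2) *\<^sub>R (V - p)) \<bullet> (x - p) + (1/4) * ?q x" for x
      by (simp add: algebra_simps inner_commute field_simps)
    note eq = this
    show ?thesis
      unfolding eq expand lin_scale by simp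
  qed
  define s where "s = X + Y + Z - 3 *\<^sub>R p"
  have middle: "integral ?T (\<lambda>x. ?q ((1/2) *\<^sub>R (X + Y + Z) + (-1/2) *\<^sub>R x)) =
      ?m * (s \<bullet> s / 4) - lin s / 2 + J / 4"
  proof -
    have gen: "((1/2) *\<^sub>R s - (1/2) *\<^sub>R y) \<bullet> ((1/2) *\<^sub>R s - (1/2) *\<^sub>R y) =
        s \<bullet> s / 4 + ((-1/2) *\<^sub>R s) \<bullet> y + (1/4) * (y \<bullet> y)" for y
      by (simp add: inner_diff_left inner_diff_right inner_commute field_simps)
    have eq0: "(1/2) *\<^sub>R (X + Y + Z) + (-1/2) *\<^sub>R x - p = (1/2) *\<^sub>R s - (1/2) *\<^sub>R (x - p)" for x
      by (simp add: s_def vec_eq_iff forall_2 field_simps)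
    have "?q ((1/2) *\<^sub>R (X + Y + Z) + (-1/2) *\<^sub>R x) = s \<bullet> s / 4 + ((-1/2) *\<^sub>R s) \<bullet> (x - p) + (1/4) * ?q x" for x
      unfolding eq0 by (rule gen)
    note eq = this
    show ?thesis
      unfolding eq expand lin_scale by simp
  qed
  have s: "s = (X - p) + (Y - p) + (Z - p)"
    by (simp add: s_def scaleR_left.add[of 1 2, simplified] algebra_simps)
       (simp add: vec_eq_iff)
  have lin_s: "lin s = lin (X - p) + lin (Y - p) + lin (Z - p)"
    by (simp only: s lin_add)
  have "4 * J = integral ?T (\<lambda>x. ?q ((1/2) *\<^sub>R X + (1/2) *\<^sub>R x)) +
      integral ?T (\<lambda>x. ?q ((1/2) *\<^sub>R Y + (1/2) *\<^sub>R x)) +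
      integral ?T (\<lambda>x. ?q ((1/2) *\<^sub>R Z + (1/2) *\<^sub>R x)) +
      integral ?T (\<lambda>x. ?q ((1/2) *\<^sub>R (X + Y + Z) + (-1/2) *\<^sub>R x))"
    unfolding J_def by (intro integral_triangle_subdivide[OF assms] continuous_intros)
  also have "\<dots> = ?m * ((?q X + ?q Y + ?q Z + s \<bullet> s) / 4) + J"
    unfolding corner middle lin_s by (simp add: field_simps)
  finally have "J = ?m * ((?q X + ?q Y + ?q Z + s \<bullet> s) / 12)"
    by (simp add: field_simps)
  then show ?thesis
    by (simp add: J_def s_def)
qed

section \<open>Neighbouring triangles of a mesh\<close>

text \<open>By conformity the intersection is a face of both triangles, and a face that meets the
  interior of a convex set is the whole set.\<close>

lemma mesh_interiors_disjoint:
  assumes "triangulation \<T>" "T \<in> \<T>" "T' \<in> \<T>" "T \<noteq> T'"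
  shows "interior T \<inter> interior T' = {}"
proof (rule ccontr)
  assume "interior T \<inter> interior T' \<noteq> {}"
  then obtain x where x: "x \<in> interior T" "x \<in> interior T'" by blast
  then have "x \<in> T" "x \<in> T'" using interior_subset by auto
  moreover have "(T \<inter> T') face_of T" "(T' \<inter> T) face_of T'"
    using assms unfolding triangulation_def by blast+
  ultimately have "T \<inter> T' = T" "T' \<inter> T = T'"
    using face_of_disjoint_interior x by blast+
  then show False using assms(4) by blast
qed

lemma mesh_simplexD:
  assumes "triangular_mesh \<Omega> \<T>" "convex hull {X, Y, Z} \<in> \<T>"
  shows "orient X Y Z \<noteq> 0"
  using assms orient_nonzero_simplex unfolding triangular_mesh_def by blast

lemma mesh_subset_closure:
  assumes "triangular_mesh \<Omega> \<T>" "T \<in> \<T>"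
  shows "T \<subseteq> closure \<Omega>"
  using assms unfolding triangular_mesh_def by blast

lemma mesh_inter_negligible:
  assumes "triangular_mesh \<Omega> \<T>" "T \<in> \<T>" "T' \<in> \<T>" "T \<noteq> T'"
  shows "negligible (T \<inter> T')"
proof -
  have "convex T" "convex T'"
    using assms unfolding triangular_mesh_def simplex_def by (auto intro: convex_convex_hull)
  then show ?thesis
    using mesh_interiors_disjoint[of \<T> T T'] assms
    by (simp add: negligible_convex_interior convex_Int triangular_mesh_def)
qed

text \<open>If both third vertices were on the same side of the common edge, a point slightly off
  its midpoint would be interior to both triangles.\<close>

lemma opposite_sides:
  assumes "0 < orient X Y Z" "orient X Y V \<noteq> 0"
    and disj: "interior (convex hull {X, Y, Z}) \<inter> interior (convex hull {X, Y, V}) = {}"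
  shows "orient X Y V < 0"
proof (rule ccontr)
  assume "\<not> orient X Y V < 0"
  with assms have pos: "0 < orient X Y V" by simp
  define m where "m = (1 - 1/2) *\<^sub>R X + (1/2) *\<^sub>R Y"
  define a where "a = bary X Y V Z"
  define b where "b = bary Y V X Z"
  \<comment> \<open>The choice gives \<open>e \<le> 1/4\<close>,
    \<open>e * \<bar>a\<bar> \<le> 1/4\<close> and \<open>e * \<bar>b\<bar> \<le> 1/4\<close>, while
    \<open>(1 - e) / 2\<close> is at least 3/8. So moving from the midpoint towards \<open>Z\<close>
    by the fraction \<open>e\<close> keeps the coordinates of \<open>X\<close> and \<open>Y\<close>
    in the second triangle positive.\<close>
  define e where "e = 1 / (4 + 4 * \<bar>a\<bar> + 4 * \<bar>b\<bar>)"
  have e: "0 < e" "e < 1" by (auto simp: e_def divide_simps)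
  have eq: "e * (4 + 4 * \<bar>a\<bar> + 4 * \<bar>b\<bar>) = 1" by (simp add: e_def)
  define p where "p = (1 - e) *\<^sub>R m + e *\<^sub>R Z"
  have ov: "orient Y V X \<noteq> 0" "orient V X Y \<noteq> 0" "orient Y Z X \<noteq> 0" "orient Z X Y \<noteq> 0"
    using assms orient_rotate by (metis less_irrefl)+
  have "bary X Y V p = (1 - e) / 2 + e * a" "bary Y V X p = (1 - e) / 2 + e * b"
    "bary V X Y p = e * (orient X Y Z / orient X Y V)"
    "bary X Y Z p = (1 - e) / 2" "bary Y Z X p = (1 - e) / 2" "bary Z X Y p = e"
    unfolding p_def m_def bary_affine a_def b_def using assms ov pos
    by (simp_all add: bary_def orient_rotate[of Z X Y] orient_rotate[of Y Z X] orient_rotate[of X Y V] orient_rotate[of Y V X])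
  moreover have "0 < (1 - e) / 2 + e * a" "0 < (1 - e) / 2 + e * b"
  proof -
    have "- (e * \<bar>x\<bar>) \<le> e * x" "0 \<le> e * \<bar>x\<bar>" for x
      using abs_ge_minus_self[of "e * x"] e by (simp_all add: abs_mult)
    from this[of a] this[of b]
    have "- (e * \<bar>a\<bar>) \<le> e * a" "- (e * \<bar>b\<bar>) \<le> e * b" "0 \<le> e * \<bar>a\<bar>" "0 \<le> e * \<bar>b\<bar>"
      by simp_all
    moreover have "4 * e + 4 * (e * \<bar>a\<bar>) + 4 * (e * \<bar>b\<bar>) = 1"
      using eq by (simp add: algebra_simps)
    ultimately show "0 < (1 - e) / 2 + e * a" "0 < (1 - e) / 2 + e * b"
      using e by argo+
  qed
  moreover have "0 < e * (orient X Y Z / orient X Y V)"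
    using e pos assms by simp
  ultimately have "p \<in> interior (convex hull {X, Y, Z}) \<inter> interior (convex hull {X, Y, V})"
    using assms(1,2) e by (intro IntI mem_interior_triangle) simp_all
  then show False using disj by blast
qed

lemma domain_interior_closure:
  assumes "convex_polygonal_domain \<Omega>"
  shows "interior (closure \<Omega>) = \<Omega>"
  using assms by (simp add: convex_polygonal_domain_def convex_interior_closure interior_open)

text \<open>Points just beyond the edge belong to the domain but not to the triangle, hence to some other
  triangle; conformity makes the common face of the two triangles contain the edge.\<close>

lemma mesh_neighbour:
  assumes domain: "convex_polygonal_domain \<Omega>" and mesh: "triangular_mesh \<Omega> \<T>"
    and T: "convex hull {X, Y, Z} \<in> \<T>" and "\<not> closed_segment X Y \<subseteq> frontier \<Omega>"
  obtains V where "convex hull {X, Y, V} \<in> \<T>" "convex hull {X, Y, V} \<noteq> convex hull {X, Y, Z}"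
proof -
  let ?T = "convex hull {X, Y, Z}"
  have ne: "orient X Y Z \<noteq> 0"
    using mesh T by (rule mesh_simplexD)
  then have r: "orient Y Z X \<noteq> 0" "orient Z X Y \<noteq> 0" and "X \<noteq> Y"
    using orient_rotate[of Y Z X] orient_rotate[of X Y Z] by auto
  have tri: "triangulation \<T>" "finite \<T>" and U: "\<Union>\<T> = closure \<Omega>"
    using mesh by (auto simp: triangular_mesh_def triangulation_def)
  have op: "open \<Omega>"
    using domain by (simp add: convex_polygonal_domain_def)
  have "closed_segment X Y \<subseteq> ?T"
    unfolding segment_convex_hull by (intro hull_mono) auto
  then have "closed_segment X Y \<subseteq> closure \<Omega>"
    using T U by blast
  \<comment> \<open>The point must be found strictly between \<open>X\<close> and \<open>Y\<close>:
    the face property used below says nothing at an endpoint.\<close>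
  then have "\<Omega> \<inter> closed_segment X Y \<noteq> {}"
    using assms(4) op by (auto simp: frontier_def interior_open)
  then have "\<Omega> \<inter> open_segment X Y \<noteq> {}"
    using open_Int_closure_eq_empty[OF op, of "open_segment X Y"] \<open>X \<noteq> Y\<close> by simp
  then obtain p where p: "p \<in> \<Omega>" "p \<in> open_segment X Y" by blast
  then obtain s where s: "p = (1 - s) *\<^sub>R X + s *\<^sub>R Y"
    unfolding in_segment by blast
  have bp: "bary Z X Y p = 0"
    unfolding s bary_affine by simp
  define H where "H = {x. bary Z X Y x < 0}"
  have "p \<noteq> Z" using bp r by auto
  \<comment> \<open>Reflecting \<open>Z\<close> in \<open>p\<close> gives a direction that leaves
    the triangle, so \<open>p\<close> is a limit of points beyond the edge.\<close>
  then have "p \<noteq> 2 *\<^sub>R p - Z" by (simp add: scaleR_2)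
  moreover have "open_segment p (2 *\<^sub>R p - Z) \<subseteq> H"
  proof
    fix x assume "x \<in> open_segment p (2 *\<^sub>R p - Z)"
    then obtain u where u: "0 < u" "x = (1 - u) *\<^sub>R p + u *\<^sub>R (2 *\<^sub>R p - Z)"
      unfolding in_segment by blast
    have "x = p + u *\<^sub>R (p - Z)" unfolding u by (simp add: algebra_simps scaleR_2)
    then have "bary Z X Y x = - u"
      using r by (simp add: bary_add_scaleR bp)
    then show "x \<in> H" using u by (simp add: H_def)
  qed
  ultimately have "p \<in> closure H"
    using closure_mono[of "open_segment p (2 *\<^sub>R p - Z)" H] closure_open_segment[of p "2 *\<^sub>R p - Z"] by auto
  then have "p \<in> closure (\<Omega> \<inter> H)"
    using open_Int_closure_subset[OF op, of H] p by blast
  \<comment> \<open>The remaining triangles are finitely many and closed; their union contains all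
    points of the domain beyond the edge, hence also their limit \<open>p\<close>.\<close>
  moreover have "closure (\<Omega> \<inter> H) \<subseteq> \<Union>(\<T> - {?T})"
  proof (rule closure_minimal)
    show "\<Omega> \<inter> H \<subseteq> \<Union>(\<T> - {?T})"
    proof
      fix x assume x: "x \<in> \<Omega> \<inter> H"
      then have "x \<notin> ?T" using ne by (auto simp: H_def mem_triangle_iff)
      moreover have "x \<in> \<Union>\<T>" unfolding U using x closure_subset by blast
      ultimately show "x \<in> \<Union>(\<T> - {?T})" by blast
    qed
    have "closed T" if "T \<in> \<T>" for T
      using that mesh simplex_triangleE compact_triangle compact_imp_closed
      unfolding triangular_mesh_def by metis
    then show "closed (\<Union>(\<T> - {?T}))"
      using tri by (intro closed_Union) auto
  qed
  ultimately obtain T' where T': "T' \<in> \<T>" "T' \<noteq> ?T" "p \<in> T'" by blast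
  have f: "(?T \<inter> T') face_of ?T" "(?T \<inter> T') face_of T'"
    using tri T T' unfolding triangulation_def by (metis Int_commute)+
  have XY: "X \<in> ?T" "Y \<in> ?T" by (simp_all add: hull_inc)
  have "p \<in> ?T"
    using p(2) \<open>closed_segment X Y \<subseteq> ?T\<close> open_closed_segment by blast
  \<comment> \<open>A face that contains a point strictly between \<open>X\<close> and
    \<open>Y\<close> contains both endpoints.\<close>
  then have XY': "X \<in> ?T \<inter> T'" "Y \<in> ?T \<inter> T'"
    using face_ofD[OF f(1) p(2) XY] T' by auto
  obtain A B C where ABC: "T' = convex hull {A, B, C}" "0 < orient A B C"
    using mesh T' simplex_triangleE by (metis triangular_mesh_def)
  \<comment> \<open>A vertex of the first triangle stays extreme in the common face, and an extreme
    point of a face is extreme in the whole of the other triangle.\<close>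
  have vertex: "v \<in> {A, B, C}" if v: "v \<in> {X, Y}" for v
  proof -
    have "v extreme_point_of ?T"
      using extreme_point_of_convex_hull_affine_independent[OF not_affine_dependent_triangle[OF ne]] v by blast
    then have "{v} face_of (?T \<inter> T')"
      using face_of_face[OF f(1)] v XY' by (auto simp: face_of_singleton)
    then have "v extreme_point_of T'"
      using face_of_face[OF f(2)] by (simp add: face_of_singleton)
    then show ?thesis
      using extreme_point_of_convex_hull_affine_independent[OF not_affine_dependent_triangle, of A B C] ABC by simp
  qed
  obtain V where "{A, B, C} = {X, Y, V}"
    using vertex[of X] vertex[of Y] \<open>X \<noteq> Y\<close> by (auto simp: insert_commute)
  then show thesis
    using that[of V] T' ABC by simp
qed

section \<open>Smooth cutoffs and integrability\<close>

lemma C1_with_gradient_continuous: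
  assumes "C1_with_gradient v G"
  shows "continuous_on A v" "continuous_on A G"
proof -
  show "continuous_on A v"
    using assms unfolding C1_with_gradient_def gderiv_def
    by (meson has_derivative_continuous continuous_at_imp_continuous_on)
  show "continuous_on A G"
    using assms continuous_on_subset unfolding C1_with_gradient_def by blast
qed

lemma C1_with_gradient_mult:
  assumes "C1_with_gradient v G" "C1_with_gradient w H"
  shows "C1_with_gradient (\<lambda>x. v x * w x) (\<lambda>x. v x *\<^sub>R H x + w x *\<^sub>R G x)"
proof -
  have "continuous_on UNIV v" "continuous_on UNIV w"
    using assms C1_with_gradient_continuous by blast+
  then show ?thesis
    using assms unfolding C1_with_gradient_def
    by (auto intro!: GDERIV_mult continuous_intros)
qed

lemma C1_with_gradient_compose:
  assumes "C1_with_gradient v G" "\<And>s. (h has_real_derivative h' s) (at s)" "continuous_on UNIV h'"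
  shows "C1_with_gradient (\<lambda>x. h (v x)) (\<lambda>x. h' (v x) *\<^sub>R G x)"
proof -
  have "continuous_on UNIV v"
    using assms(1) by (rule C1_with_gradient_continuous)
  then show ?thesis
    using assms unfolding C1_with_gradient_def
    by (intro conjI allI GDERIV_DERIV_compose continuous_on_scaleR continuous_on_compose2[OF assms(3)]) auto
qed

lemma C1_with_gradient_affine: "C1_with_gradient (\<lambda>x. c + n \<bullet> x) (\<lambda>_. n)"
  unfolding C1_with_gradient_def gderiv_def
  by (auto intro!: derivative_eq_intros continuous_intros simp: inner_commute)

lemma C1_with_gradient_quadratic: "C1_with_gradient (\<lambda>x. (1/2) * ((x - p) \<bullet> (x - p))) (\<lambda>x. x - p)"
  unfolding C1_with_gradient_def gderiv_def
  by (auto intro!: derivative_eq_intros continuous_intros simp: inner_commute)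

lemma C1_with_gradient_const: "C1_with_gradient (\<lambda>x. c) (\<lambda>_. 0)"
  unfolding C1_with_gradient_def by (auto intro!: GDERIV_const continuous_intros)

lemma C1_with_gradient_bary:
  obtains n where "C1_with_gradient (bary X Y Z) (\<lambda>_. n)"
proof -
  obtain n c where "\<And>x. bary X Y Z x = c + n \<bullet> x"
    using bary_eq_inner by blast
  then have "bary X Y Z = (\<lambda>x. c + n \<bullet> x)" by auto
  then show thesis
    using that C1_with_gradient_affine by metis
qed

text \<open>Off the closed support the function vanishes on a neighbourhood, hence so does its
  gradient. This confines the integrals of the weak divergence to the support of the test
  function.\<close>

lemma C1_with_gradient_zero:
  assumes "C1_with_gradient v G" "x \<notin> closure {x. v x \<noteq> 0}"
  shows "v x = 0" "G x = 0"
proof -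
  show "v x = 0" using assms(2) closure_subset[of "{x. v x \<noteq> 0}"] by (metis (mono_tags) mem_Collect_eq subsetD)
  have 1: "(v has_derivative (\<lambda>h. h \<bullet> G x)) (at x)"
    using assms(1) unfolding C1_with_gradient_def gderiv_def by blast
  have "(v has_derivative (\<lambda>h. 0)) (at x)"
  proof (rule has_derivative_transform_within_open[of "\<lambda>_. 0"])
    show "open (- closure {x. v x \<noteq> 0})" by (intro open_Compl closed_closure)
    show "0 = v y" if "y \<in> - closure {x. v x \<noteq> 0}" for y
      using that closure_subset[of "{x. v x \<noteq> 0}"] by (metis (mono_tags) ComplD mem_Collect_eq subsetD)
    show "x \<in> - closure {x. v x \<noteq> 0}" using assms(2) by simp
    show "((\<lambda>_. 0) has_derivative (\<lambda>h. 0)) (at x)" by simp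
  qed
  then have "(\<lambda>h. h \<bullet> G x) = (\<lambda>h. 0)"
    using has_derivative_unique 1 by blast
  then have "G x \<bullet> G x = 0" by metis
  then show "G x = 0" by simp
qed

text \<open>Squaring the positive part makes the function continuously differentiable across 0,
  which is all the smoothness that test functions must have. It vanishes exactly for
  \<open>s \<le> 0\<close>, stays in \<open>[0,1]\<close> and tends to 1.\<close>

definition cutoff :: "real \<Rightarrow> real" where
  "cutoff s = (max 0 s)\<^sup>2 / (1 + (max 0 s)\<^sup>2)"

lemma cutoff_derivative:
  "(cutoff has_real_derivative 2 * max 0 s / (1 + (max 0 s)\<^sup>2)\<^sup>2) (at s)"
proof -
  have sq: "((\<lambda>s::real. (max 0 s)\<^sup>2) has_real_derivative 2 * max 0 s) (at s)"
  proof -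
    consider "s < 0" | "s > 0" | "s = 0" by linarith
    then show ?thesis
    proof cases
      case 1
      show ?thesis
        by (rule has_field_derivative_transform_within_open[of "\<lambda>_. 0" _ _ "{..<0}"])
           (use 1 in \<open>auto simp: max_def\<close>)
    next
      case 2
      show ?thesis
        by (rule has_field_derivative_transform_within_open[of "\<lambda>s. s\<^sup>2" _ _ "{0<..}"])
           (use 2 in \<open>auto simp: max_def intro!: derivative_eq_intros\<close>)
    next
      case 3
      have "((\<lambda>h. (max 0 h)\<^sup>2 / h) \<longlongrightarrow> 0) (at (0::real))"
      proof (rule Lim_null_comparison)
        show "\<forall>\<^sub>F h in at (0::real). norm ((max 0 h)\<^sup>2 / h) \<le> \<bar>h\<bar>"
          by (intro always_eventually) (auto simp: max_def power2_eq_square)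
        show "((\<lambda>h. \<bar>h\<bar>) \<longlongrightarrow> 0) (at (0::real))"
          by (intro tendsto_rabs_zero tendsto_ident_at)
      qed
      then show ?thesis
        unfolding 3 DERIV_def by simp
    qed
  qed
  have pos: "1 + (max 0 s)\<^sup>2 \<noteq> 0"
    by (metis add_pos_nonneg less_irrefl zero_le_power2 zero_less_one)
  have "((\<lambda>s. (max 0 s)\<^sup>2 / (1 + (max 0 s)\<^sup>2)) has_real_derivative
      (2 * max 0 s * (1 + (max 0 s)\<^sup>2) - (max 0 s)\<^sup>2 * (0 + 2 * max 0 s)) /
        ((1 + (max 0 s)\<^sup>2) * (1 + (max 0 s)\<^sup>2))) (at s)"
    using pos by (intro DERIV_divide sq DERIV_add DERIV_const)
  moreover have "(2 * max 0 s * (1 + (max 0 s)\<^sup>2) - (max 0 s)\<^sup>2 * (0 + 2 * max 0 s)) /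
        ((1 + (max 0 s)\<^sup>2) * (1 + (max 0 s)\<^sup>2)) = 2 * max 0 s / (1 + (max 0 s)\<^sup>2)\<^sup>2"
    by (simp add: algebra_simps power2_eq_square[of "_ + _"])
  ultimately show ?thesis
    unfolding cutoff_def by simp
qed

lemma continuous_on_cutoff_derivative: "continuous_on A (\<lambda>s::real. 2 * max 0 s / (1 + (max 0 s)\<^sup>2)\<^sup>2)"
proof -
  have "1 + (max 0 s)\<^sup>2 \<noteq> 0" for s :: real
    by (metis add_pos_nonneg less_irrefl zero_le_power2 zero_less_one)
  then show ?thesis
    by (intro continuous_intros) auto
qed

lemma continuous_on_cutoff: "continuous_on A cutoff"
  by (rule DERIV_continuous_on[OF has_field_derivative_at_within[OF cutoff_derivative]])

lemma cutoff_eq_0_iff: "cutoff s = 0 \<longleftrightarrow> s \<le> 0"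
proof -
  have "1 + (max 0 s)\<^sup>2 \<noteq> 0"
    using zero_le_power2[of "max 0 s"] by linarith
  then show ?thesis unfolding cutoff_def by (simp add: max_def)
qed

lemma cutoff_bounds: "0 \<le> cutoff s" "cutoff s \<le> 1"
proof -
  have "0 < 1 + (max 0 s)\<^sup>2"
    by (simp add: add_pos_nonneg)
  then show "0 \<le> cutoff s" "cutoff s \<le> 1" by (simp_all add: cutoff_def)
qed

text \<open>Subtracting 1 makes the \<open>k\<close>-th function vanish for
  \<open>s \<le> 1 / (k + 1)\<close>, so its support keeps away from 0, while at a fixed positive
  \<open>s\<close> the argument still tends to infinity.\<close>

lemma cutoff_tendsto_1: "0 < s \<Longrightarrow> (\<lambda>k. cutoff (real (Suc k) * s - 1)) \<longlonglongrightarrow> 1"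
proof -
  assume s: "0 < s"
  have "(cutoff \<longlongrightarrow> 1) at_top"
  proof (rule Lim_transform_eventually)
    have "filterlim (\<lambda>x::real. 1 + x\<^sup>2) at_top at_top"
      by (intro filterlim_tendsto_add_at_top[OF tendsto_const] filterlim_pow_at_top filterlim_ident) auto
    then have "((\<lambda>x::real. 1 - 1 / (1 + x\<^sup>2)) \<longlongrightarrow> 1 - 0) at_top"
      by (intro tendsto_diff tendsto_const tendsto_divide_0[OF tendsto_const] filterlim_at_top_imp_at_infinity)
    then show "((\<lambda>x::real. 1 - 1 / (1 + x\<^sup>2)) \<longlongrightarrow> 1) at_top" by simp
    show "\<forall>\<^sub>F x in at_top. 1 - 1 / (1 + x\<^sup>2) = cutoff x"
      using eventually_ge_at_top[of "0::real"]
    proof eventually_elim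
      case (elim x)
      have "1 + x\<^sup>2 \<noteq> 0" by (metis add_pos_nonneg less_irrefl zero_le_power2 zero_less_one)
      then show ?case using elim by (simp add: cutoff_def field_simps)
    qed
  qed
  moreover have "filterlim (\<lambda>k. real (Suc k) * s - 1) at_top sequentially"
  proof -
    have "filterlim (\<lambda>k. -1 + s * real (Suc k)) at_top sequentially"
      by (intro filterlim_tendsto_add_at_top[OF tendsto_const]
          filterlim_tendsto_pos_mult_at_top[OF tendsto_const s]
          filterlim_compose[OF filterlim_real_sequentially filterlim_Suc])
    then show ?thesis by (simp add: mult.commute)
  qed
  ultimately show ?thesis
    by (rule filterlim_compose)
qed

lemma C1_with_gradient_cutoff_bary:
  obtains G where "C1_with_gradient (\<lambda>x. cutoff (k * bary X Y Z x - 1)) G"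
proof -
  obtain n c where n: "\<And>x. bary X Y Z x = c + n \<bullet> x"
    using bary_eq_inner by blast
  have "k * bary X Y Z x - 1 = (k * c - 1) + (k *\<^sub>R n) \<bullet> x" for x
    unfolding n by (simp add: algebra_simps)
  then have eq: "(\<lambda>x. cutoff (k * bary X Y Z x - 1)) = (\<lambda>x. cutoff ((k * c - 1) + (k *\<^sub>R n) \<bullet> x))"
    by presburger
  show thesis
    using that[unfolded eq] C1_with_gradient_compose[OF C1_with_gradient_affine[of "k * c - 1" "k *\<^sub>R n"]
        cutoff_derivative continuous_on_cutoff_derivative] by blast
qed

section \<open>Integrability on the domain and on closed triangles\<close>

lemma L2_on_absolutely_integrable:
  assumes "L2_on \<Omega> f" "open \<Omega>" "bounded \<Omega>"
  shows "f absolutely_integrable_on \<Omega>"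
proof -
  have \<Omega>: "\<Omega> \<in> lmeasurable"
    using assms by (simp add: lmeasurable_open)
  show ?thesis
  proof (rule measurable_bounded_by_integrable_imp_absolutely_integrable)
    show "f \<in> borel_measurable (lebesgue_on \<Omega>)"
      using assms by (simp add: L2_on_def)
    show "\<Omega> \<in> sets lebesgue" using \<Omega> by blast
    show "(\<lambda>x. 1 + (norm (f x))\<^sup>2) integrable_on \<Omega>"
      using assms \<Omega> by (intro integrable_add integrable_on_const integrable_on_lebesgue_on)
        (auto simp: L2_on_def)
    show "norm (f x) \<le> 1 + (norm (f x))\<^sup>2" for x
    proof -
      have "0 \<le> (norm (f x) - 1)\<^sup>2 + norm (f x)" by simp
      then show ?thesis by (simp add: power2_diff)
    qed
  qed
qed

text \<open>Closed triangles may touch the boundary of the domain, outside of which nothing is known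
  about \<open>f\<close>; the part in question lies in the frontier of a convex set and is
  null.\<close>

lemma absolutely_integrable_on_closure_subset:
  fixes f :: "'a::euclidean_space \<Rightarrow> 'b::euclidean_space"
  assumes "f absolutely_integrable_on \<Omega>" "open \<Omega>" "convex \<Omega>" "compact T" "T \<subseteq> closure \<Omega>"
  shows "f absolutely_integrable_on T"
proof -
  have "f absolutely_integrable_on (T \<inter> \<Omega>)"
    using assms by (intro set_integrable_subset[OF assms(1)] sets.Int) (auto simp: fmeasurableD lmeasurable_compact)
  moreover have "negligible (T - \<Omega>)"
    using assms negligible_convex_frontier[OF assms(3)]
    by (auto simp: frontier_def interior_open intro: negligible_subset)
  ultimately show ?thesis
    by (subst absolutely_integrable_spike_set_eq[of _ "T \<inter> \<Omega>"]) (auto intro: negligible_subset)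
qed

lemma absolutely_integrable_times_continuous:
  fixes f :: "'a::euclidean_space \<Rightarrow> real"
  assumes "f absolutely_integrable_on T" "compact T" "continuous_on T w"
  shows "(\<lambda>x. f x * w x) absolutely_integrable_on T"
proof -
  have "(\<lambda>x. w x * f x) absolutely_integrable_on T"
    using assms by (intro absolutely_integrable_bounded_measurable_product[OF bilinear_times]
      continuous_imp_measurable_on_sets_lebesgue compact_imp_bounded compact_continuous_image)
      (auto simp: lmeasurable_compact fmeasurableD)
  then show ?thesis by (simp add: mult.commute)
qed

lemma absolutely_integrable_inner_continuous:
  fixes f :: "'a::euclidean_space \<Rightarrow> 'b::euclidean_space"
  assumes "f absolutely_integrable_on T" "compact T" "continuous_on T w"
  shows "(\<lambda>x. f x \<bullet> w x) absolutely_integrable_on T"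
proof -
  have "(\<lambda>x. w x \<bullet> f x) absolutely_integrable_on T"
    using assms by (intro absolutely_integrable_bounded_measurable_product[OF bilinear_conv_bounded_bilinear[THEN iffD2, OF bounded_bilinear_inner]]
      continuous_imp_measurable_on_sets_lebesgue compact_imp_bounded compact_continuous_image)
      (auto simp: lmeasurable_compact fmeasurableD)
  then show ?thesis by (simp add: inner_commute)
qed

section \<open>Balance of normal traces across an edge\<close>

lemma edge_integrable_times:
  assumes "edge_integrable X Y g" "continuous_on UNIV v"
  shows "(\<lambda>t. g (linepath X Y t) * v (linepath X Y t)) absolutely_integrable_on {0..1}"
  using assms unfolding edge_integrable_def
  by (intro absolutely_integrable_times_continuous continuous_on_compose2[OF assms(2)])
    (auto intro!: continuous_on_linepath)

lemma edge_integral_eq: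
  assumes "edge_integrable X Y g" "continuous_on UNIV v"
  shows "edge_integral X Y (\<lambda>x. g x * v x) =
    dist X Y * integral {0..1} (\<lambda>t. g (linepath X Y t) * v (linepath X Y t))"
  using set_lebesgue_integral_eq_integral(2)[OF edge_integrable_times[OF assms]]
  by (simp add: edge_integral_def)

lemma edge_integral_eq_0:
  assumes "AE t in lebesgue. t \<in> {0..1} \<longrightarrow> f (linepath X Y t) = 0"
  shows "edge_integral X Y f = 0"
proof -
  have "AE t in lebesgue. indicator {0..1} t *\<^sub>R f (linepath X Y t) = 0"
    using assms by eventually_elim (auto simp: indicator_def)
  then show ?thesis
    unfolding edge_integral_def set_lebesgue_integral_def by (simp add: integral_eq_zero_AE)
qed

text \<open>The weight is the restriction to an edge of the four cutoffs used in the balance of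
  traces below. It lies between 0 and 1, so \<bar>a\<bar> dominates.\<close>

lemma integral_cutoff_tendsto:
  fixes a :: "real \<Rightarrow> real"
  assumes a: "a absolutely_integrable_on {0..1}"
  shows "(\<lambda>k. integral {0..1} (\<lambda>t. a t * ((cutoff (real (Suc k) * (1 - t) - 1))\<^sup>2 *
      (cutoff (real (Suc k) * t - 1))\<^sup>2))) \<longlonglongrightarrow> integral {0..1} a"
proof -
  let ?c = "\<lambda>k t. (cutoff (real (Suc k) * (1 - t) - 1))\<^sup>2 * (cutoff (real (Suc k) * t - 1))\<^sup>2"
  \<comment> \<open>At the two endpoints every weight is 0, so there the pointwise limit is 0 and
    not \<open>a t\<close>.\<close>
  let ?b = "\<lambda>t. if t = 0 \<or> t = 1 then 0 else a t"
  have "(\<lambda>k. integral {0..1} (\<lambda>t. a t * ?c k t)) \<longlonglongrightarrow> integral {0..1} ?b"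
  proof (rule dominated_convergence(2)[where h = "\<lambda>t. \<bar>a t\<bar>"])
    show "(\<lambda>t. a t * ?c k t) integrable_on {0..1}" for k
      by (intro set_lebesgue_integral_eq_integral(1) absolutely_integrable_times_continuous a
        continuous_intros continuous_on_compose2[OF continuous_on_cutoff]) auto
    show "(\<lambda>t. \<bar>a t\<bar>) integrable_on {0..1}"
      using a absolutely_integrable_abs_iff set_lebesgue_integral_eq_integral(1)
      by (metis set_integrable_abs)
    show "norm (a t * ?c k t) \<le> \<bar>a t\<bar>" for k t
    proof -
      have "0 \<le> ?c k t" "?c k t \<le> 1"
        using cutoff_bounds by (auto intro!: mult_le_one power_le_one)
      then show ?thesis
        by (simp add: abs_mult mult_left_le)
    qed
    show "(\<lambda>k. a t * ?c k t) \<longlonglongrightarrow> ?b t" if t: "t \<in> {0..1}" for t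
    proof (cases "t = 0 \<or> t = 1")
      case True
      then have "?c k t = 0" for k
        using cutoff_eq_0_iff[of "-1"] by auto
      note c0 = this
      show ?thesis unfolding c0 using True by simp
    next
      case False
      then have "0 < t" "0 < 1 - t" using t by auto
      then have "(\<lambda>k. a t * ?c k t) \<longlonglongrightarrow> a t * (1\<^sup>2 * 1\<^sup>2)"
        by (intro tendsto_intros cutoff_tendsto_1)
      then show ?thesis using False by simp
    qed
  qed
  moreover have "integral {0..1} ?b = integral {0..1} a"
    by (rule integral_spike[of "{0, 1}"]) auto
  ultimately show ?thesis by simp
qed

text \<open>A statement on one triangle with an arbitrary divergence and trace: on a triangle where
  the field vanishes the trace may then be replaced by the zero function.\<close>

definition green_formula ::
    "(real^2 \<Rightarrow> real^2) \<Rightarrow> (real^2 \<Rightarrow> real) \<Rightarrow> (real^2 \<Rightarrow> real) \<Rightarrow> real^2 \<Rightarrow> real^2 \<Rightarrow> real^2 \<Rightarrow> bool" where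
  "green_formula q d g X Y Z \<longleftrightarrow>
     edge_integrable X Y g \<and> edge_integrable Y Z g \<and> edge_integrable Z X g \<and>
     (\<forall>v G. C1_with_gradient v G \<longrightarrow>
        (LINT x:convex hull {X, Y, Z}|lebesgue. q x \<bullet> G x + d x * v x) =
          edge_integral X Y (\<lambda>x. g x * v x) +
          edge_integral Y Z (\<lambda>x. g x * v x) +
          edge_integral Z X (\<lambda>x. g x * v x))"

lemma has_normal_traces_green:
  assumes "has_normal_traces \<Omega> \<T> q g" "convex hull {X, Y, Z} \<in> \<T>"
  shows "green_formula q (divergence \<Omega> q) (g (convex hull {X, Y, Z})) X Y Z"
  using assms unfolding has_normal_traces_def green_formula_def by blast

lemma green_formula_zero:
  assumes "AE x in lebesgue. x \<in> convex hull {X, Y, Z} \<longrightarrow> q x = 0"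
    and "AE x in lebesgue. x \<in> convex hull {X, Y, Z} \<longrightarrow> d x = 0"
  shows "green_formula q d (\<lambda>_. 0) X Y Z"
proof -
  have "(LINT x:convex hull {X, Y, Z}|lebesgue. q x \<bullet> G x + d x * v x) = 0" for G v
  proof -
    have "AE x in lebesgue. indicator (convex hull {X, Y, Z}) x *\<^sub>R (q x \<bullet> G x + d x * v x) = 0"
      using assms by eventually_elim (auto simp: indicator_def)
    then show ?thesis
      unfolding set_lebesgue_integral_def by (rule integral_eq_zero_AE)
  qed
  then show ?thesis
    by (simp add: green_formula_def edge_integrable_def edge_integral_def set_integrable_def)
qed

lemma absolutely_integrable_green_integrand:
  fixes q :: "'a::euclidean_space \<Rightarrow> 'b::euclidean_space"
  assumes "q absolutely_integrable_on \<Omega>" "d absolutely_integrable_on \<Omega>"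
    and "open \<Omega>" "convex \<Omega>" "compact T" "T \<subseteq> closure \<Omega>"
    and "continuous_on T G" "continuous_on T v"
  shows "(\<lambda>x. q x \<bullet> G x + d x * v x) absolutely_integrable_on T"
proof -
  have "q absolutely_integrable_on T" "d absolutely_integrable_on T"
    using absolutely_integrable_on_closure_subset[OF assms(1,3-6)]
      absolutely_integrable_on_closure_subset[OF assms(2-6)] .
  then show ?thesis
    using assms by (intro set_integral_add(1) absolutely_integrable_inner_continuous
      absolutely_integrable_times_continuous)
qed

text \<open>A cutoff supported in the union of the two triangles and tending to 1 inside the common edge
  turns the weak divergence into the equality of the two normal traces.\<close>

lemma flux_balance:
  assumes \<Omega>: "open \<Omega>" "convex \<Omega>" "bounded \<Omega>" "interior (closure \<Omega>) = \<Omega>"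
    and q: "q absolutely_integrable_on \<Omega>" and d: "d absolutely_integrable_on \<Omega>"
    and weak: "has_weak_divergence \<Omega> q d"
    and sub: "convex hull {X, Y, Z} \<subseteq> closure \<Omega>" "convex hull {X, Y, V} \<subseteq> closure \<Omega>"
    and pos: "0 < orient X Y Z" and neg: "orient X Y V < 0"
    and null: "negligible (convex hull {X, Y, Z} \<inter> convex hull {X, Y, V})"
    and green: "green_formula q d g X Y Z" "green_formula q d g' X Y V"
    and v: "C1_with_gradient v G"
  shows "edge_integral X Y (\<lambda>x. g x * v x) = - edge_integral X Y (\<lambda>x. g' x * v x)"
proof -
  let ?T = "convex hull {X, Y, Z}" and ?T' = "convex hull {X, Y, V}"
  have ne: "orient X Y Z \<noteq> 0" "orient Y Z X \<noteq> 0" "orient Z X Y \<noteq> 0"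
    "orient X Y V \<noteq> 0" "orient Y V X \<noteq> 0" "orient V X Y \<noteq> 0"
    using pos neg orient_rotate by (metis less_irrefl)+
  \<comment> \<open>Only the coordinates of the common vertices \<open>X\<close> and
    \<open>Y\<close> are cut off, once in each triangle. Those of \<open>Z\<close> and
    \<open>V\<close> vanish on the common edge, and cutting them off would kill the test function
    there.\<close>
  define b where "b k x = cutoff (k * bary X Y Z x - 1) * cutoff (k * bary Y Z X x - 1) *
    (cutoff (k * bary X Y V x - 1) * cutoff (k * bary Y V X x - 1))" for k x
  define w where "w k x = b (real (Suc k)) x * v x" for k x
  define U where "U = {x. 0 < bary X Y Z x} \<inter> {x. 0 < bary Y Z X x} \<inter>
    ({x. 0 < bary X Y V x} \<inter> {x. 0 < bary Y V X x})"
  have UT: "U \<subseteq> ?T \<union> ?T'"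
  proof
    fix x assume x: "x \<in> U"
    \<comment> \<open>The coordinates of \<open>Z\<close> and \<open>V\<close>, left out of
      \<open>U\<close>, have the same numerator \<open>orient X Y x\<close> and denominators of
      opposite sign, so at every point at least one of them is nonnegative.\<close>
    have rot: "bary Z X Y x = orient X Y x / orient X Y Z" "bary V X Y x = orient X Y x / orient X Y V"
      unfolding bary_def by (simp_all only: orient_rotate[of X Y x] orient_rotate[of X Y Z] orient_rotate[of X Y V])
    show "x \<in> ?T \<union> ?T'"
    proof (cases "0 \<le> orient X Y x")
      case True
      then have "0 \<le> bary Z X Y x" using pos by (simp add: rot)
      then show ?thesis using x ne by (auto simp: U_def mem_triangle_iff)
    next
      case False
      then have "0 \<le> bary V X Y x" using neg by (simp add: rot divide_nonpos_nonpos)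
      then show ?thesis using x ne by (auto simp: U_def mem_triangle_iff)
    qed
  qed
  have "open U"
    unfolding U_def by (intro open_Int open_Collect_less) (rule continuous_on_bary continuous_on_const)+
  \<comment> \<open>An open subset of the closure lies in its interior, which for the convex domain
    is the domain itself.\<close>
  then have U\<Omega>: "U \<subseteq> \<Omega>"
    using interior_maximal[of U "closure \<Omega>"] UT sub \<Omega>(4) by blast
  have int: "(\<lambda>x. q x \<bullet> G x + d x * v x) absolutely_integrable_on T"
    if "C1_with_gradient v G" "compact T" "T \<subseteq> closure \<Omega>" for v G T
    using that q d \<Omega> by (intro absolutely_integrable_green_integrand C1_with_gradient_continuous)
  have balance: "edge_integral X Y (\<lambda>x. g x * w k x) + edge_integral X Y (\<lambda>x. g' x * w k x) = 0" for k
  proof -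
    obtain H where H: "C1_with_gradient (w k) H"
    proof -
      let ?r = "real (Suc k)"
      obtain G1 G2 G3 G4 where
        "C1_with_gradient (\<lambda>x. cutoff (?r * bary X Y Z x - 1)) G1"
        "C1_with_gradient (\<lambda>x. cutoff (?r * bary Y Z X x - 1)) G2"
        "C1_with_gradient (\<lambda>x. cutoff (?r * bary X Y V x - 1)) G3"
        "C1_with_gradient (\<lambda>x. cutoff (?r * bary Y V X x - 1)) G4"
        using C1_with_gradient_cutoff_bary by metis
      then show thesis
        using that[unfolded w_def[abs_def] b_def, OF C1_with_gradient_mult[OF C1_with_gradient_mult[OF
          C1_with_gradient_mult C1_with_gradient_mult]]] v by blast
    qed
    \<comment> \<open>Where \<open>w k\<close> is nonzero every scaled coordinate exceeds 1. The
      corresponding closed conditions survive passing to the closure and keep the support inside the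
      open set \<open>U\<close>.\<close>
    define C where "C = {x. 1 \<le> real (Suc k) * bary X Y Z x} \<inter> {x. 1 \<le> real (Suc k) * bary Y Z X x} \<inter>
      ({x. 1 \<le> real (Suc k) * bary X Y V x} \<inter> {x. 1 \<le> real (Suc k) * bary Y V X x})"
    have "closed C"
      unfolding C_def by (intro closed_Int closed_Collect_le continuous_intros)
    moreover have "{x. w k x \<noteq> 0} \<subseteq> C"
      unfolding C_def w_def b_def by (auto simp: cutoff_eq_0_iff)
    ultimately have clC: "closure {x. w k x \<noteq> 0} \<subseteq> C"
      by (simp add: closure_minimal)
    have "0 < y" if "1 \<le> real (Suc k) * y" for y
      using that by (metis less_le_trans of_nat_0_less_iff zero_less_Suc zero_less_mult_pos zero_less_one)
    then have "C \<subseteq> U" unfolding C_def U_def by blast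
    then have cl: "closure {x. w k x \<noteq> 0} \<subseteq> U" using clC by blast
    have "bounded (closure {x. w k x \<noteq> 0})"
      using cl U\<Omega> \<Omega>(3) bounded_subset by (metis subset_trans)
    then have "compact (closure {x. w k x \<noteq> 0})"
      by (simp add: compact_eq_bounded_closed)
    then have weak': "(LINT x:\<Omega>|lebesgue. q x \<bullet> H x) = - (LINT x:\<Omega>|lebesgue. d x * w k x)"
      using weak H cl U\<Omega> unfolding has_weak_divergence_def by blast
    let ?f = "\<lambda>x. q x \<bullet> H x + d x * w k x"
    have z: "w k x = 0" "H x = 0" if "x \<notin> U" for x
      using C1_with_gradient_zero[OF H] that cl by blast+
    then have fz: "?f x = 0" if "x \<notin> U" for x
      using that by simp
    have c\<Omega>: "compact (closure \<Omega>)" using \<Omega> by (simp add: compact_closure)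
    have "(\<lambda>x. q x \<bullet> H x) absolutely_integrable_on closure \<Omega>"
      "(\<lambda>x. d x * w k x) absolutely_integrable_on closure \<Omega>"
      using \<Omega> q d c\<Omega> by (intro absolutely_integrable_inner_continuous
        absolutely_integrable_times_continuous C1_with_gradient_continuous[OF H]
        absolutely_integrable_on_closure_subset[where \<Omega> = \<Omega> and T = "closure \<Omega>"]; simp)+
    moreover have "f absolutely_integrable_on \<Omega>" if "f absolutely_integrable_on closure \<Omega>" for f :: "real^2 \<Rightarrow> real"
      using \<Omega>(1) by (intro set_integrable_subset[OF that _ closure_subset]) simp
    ultimately have i: "(\<lambda>x. q x \<bullet> H x) absolutely_integrable_on \<Omega>"
      "(\<lambda>x. d x * w k x) absolutely_integrable_on \<Omega>"
      by blast+
    have "integral \<Omega> ?f = (LINT x:\<Omega>|lebesgue. ?f x)"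
      by (intro set_lebesgue_integral_eq_integral(2)[symmetric] set_integral_add(1) i)
    also have "\<dots> = 0"
      using set_integral_add(2)[OF i] weak' by simp
    finally have "integral \<Omega> ?f = 0" .
    moreover have "integral \<Omega> ?f = integral (?T \<union> ?T') ?f"
    proof (rule integral_spike_set)
      have "{x \<in> \<Omega> - (?T \<union> ?T'). ?f x \<noteq> 0} = {}" using fz UT by blast
      then show "negligible {x \<in> \<Omega> - (?T \<union> ?T'). ?f x \<noteq> 0}" by (simp only: negligible_empty)
      have "{x \<in> (?T \<union> ?T') - \<Omega>. ?f x \<noteq> 0} = {}" using fz U\<Omega> by blast
      then show "negligible {x \<in> (?T \<union> ?T') - \<Omega>. ?f x \<noteq> 0}" by (simp only: negligible_empty)
    qed
    moreover have "integral (?T \<union> ?T') ?f = integral ?T ?f + integral ?T' ?f"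
      using int[OF H compact_triangle sub(1)] int[OF H compact_triangle sub(2)] null
      by (intro integral_unique has_integral_Un integrable_integral set_lebesgue_integral_eq_integral(1))
    moreover have "integral ?T ?f = edge_integral X Y (\<lambda>x. g x * w k x)"
    proof -
      \<comment> \<open>On each of the other two edges the coordinate of \<open>X\<close> or of
        \<open>Y\<close> is 0, and its cutoff is evaluated at -1.\<close>
      have "w k (linepath Y Z t) = 0" "w k (linepath Z X t) = 0" for t
        unfolding w_def b_def linepath_def bary_affine by (simp_all add: cutoff_eq_0_iff)
      then have "edge_integral Y Z (\<lambda>x. g x * w k x) = 0" "edge_integral Z X (\<lambda>x. g x * w k x) = 0"
        by (intro edge_integral_eq_0; simp)+
      then show ?thesis
        using green(1) H set_lebesgue_integral_eq_integral(2)[OF int[OF H compact_triangle sub(1)]]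
        unfolding green_formula_def by auto
    qed
    moreover have "integral ?T' ?f = edge_integral X Y (\<lambda>x. g' x * w k x)"
    proof -
      have "w k (linepath Y V t) = 0" "w k (linepath V X t) = 0" for t
        unfolding w_def b_def linepath_def bary_affine by (simp_all add: cutoff_eq_0_iff)
      then have "edge_integral Y V (\<lambda>x. g' x * w k x) = 0" "edge_integral V X (\<lambda>x. g' x * w k x) = 0"
        by (intro edge_integral_eq_0; simp)+
      then show ?thesis
        using green(2) H set_lebesgue_integral_eq_integral(2)[OF int[OF H compact_triangle sub(2)]]
        unfolding green_formula_def by auto
    qed
    ultimately show ?thesis by linarith
  qed
  have lim: "(\<lambda>k. edge_integral X Y (\<lambda>x. g x * w k x)) \<longlonglongrightarrow> edge_integral X Y (\<lambda>x. g x * v x)"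
    if g: "edge_integrable X Y g" for g
  proof -
    have cv: "continuous_on UNIV v"
      using v by (rule C1_with_gradient_continuous)
    have cw: "continuous_on UNIV (w k)" for k
      unfolding w_def[abs_def] b_def
      by (intro continuous_intros cv continuous_on_compose2[OF continuous_on_cutoff]) auto
    have lp: "linepath X Y t = (1 - t) *\<^sub>R X + t *\<^sub>R Y" for t
      by (simp add: linepath_def)
    \<comment> \<open>Along the common edge the coordinates of \<open>X\<close> and \<open>Y\<close>
      are \<open>1 - t\<close> and \<open>t\<close> in both triangles, so each cutoff occurs
      twice.\<close>
    have "g (linepath X Y t) * w k (linepath X Y t) = g (linepath X Y t) * v (linepath X Y t) *
      ((cutoff (real (Suc k) * (1 - t) - 1))\<^sup>2 * (cutoff (real (Suc k) * t - 1))\<^sup>2)" for k t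
      unfolding w_def b_def lp bary_affine using ne
      by (simp add: power2_eq_square mult_ac)
    note eq = this
    show ?thesis
      unfolding edge_integral_eq[OF g cw] edge_integral_eq[OF g cv] eq
      by (intro tendsto_mult tendsto_const integral_cutoff_tendsto edge_integrable_times[OF g cv])
  qed
  have "(\<lambda>k. edge_integral X Y (\<lambda>x. g x * w k x) + edge_integral X Y (\<lambda>x. g' x * w k x)) \<longlonglongrightarrow>
      edge_integral X Y (\<lambda>x. g x * v x) + edge_integral X Y (\<lambda>x. g' x * v x)"
    using green by (intro tendsto_add lim) (auto simp: green_formula_def)
  then show ?thesis
    unfolding balance using LIMSEQ_const_iff[of "0::real"] by simp
qed

text \<open>The product of the three barycentric coordinates is a bubble function: it vanishes on
  all edges, so Green's formula has no boundary term and leaves \<open>c\<close> times a nonzero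
  integral.\<close>

lemma divergence_constant_zero:
  assumes ne: "orient X Y Z \<noteq> 0"
    and green: "green_formula q d g X Y Z"
    and q: "AE x in lebesgue. x \<in> convex hull {X, Y, Z} \<longrightarrow> q x = 0"
    and d: "AE x in lebesgue. x \<in> convex hull {X, Y, Z} \<longrightarrow> d x = c"
    and int: "q absolutely_integrable_on convex hull {X, Y, Z}" "d absolutely_integrable_on convex hull {X, Y, Z}"
  shows "c = 0"
proof -
  let ?T = "convex hull {X, Y, Z}"
  let ?v = "\<lambda>x. bary X Y Z x * bary Y Z X x * bary Z X Y x"
  have r: "orient Y Z X \<noteq> 0" "orient Z X Y \<noteq> 0"
    using ne orient_rotate[of Y Z X] orient_rotate[of X Y Z] by auto
  obtain G where G: "C1_with_gradient ?v G"
  proof -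
    obtain n1 n2 n3 where "C1_with_gradient (bary X Y Z) n1" "C1_with_gradient (bary Y Z X) n2"
      "C1_with_gradient (bary Z X Y) n3"
      using C1_with_gradient_bary by metis
    then show thesis
      using that[OF C1_with_gradient_mult[OF C1_with_gradient_mult]] by blast
  qed
  note cont = C1_with_gradient_continuous[OF G]
  have zero: "edge_integral A B (\<lambda>x. g x * ?v x) = 0" if "bary A' B' C' = b" "b A = 0" "b B = 0"
     "b \<in> {bary X Y Z, bary Y Z X, bary Z X Y}" for A B b A' B' C'
  proof -
    have "?v (linepath A B t) = 0" for t
      using that bary_affine[of A' B' C' t A B] by (auto simp: linepath_def)
    then show ?thesis by (intro edge_integral_eq_0) simp
  qed
  have "(LINT x:?T|lebesgue. q x \<bullet> G x + d x * ?v x) = 0"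
    using green G zero[of X Y Z _ Y Z] zero[of Y Z X _ Z X] zero[of Z X Y _ X Y]
    unfolding green_formula_def by auto
  moreover have "(LINT x:?T|lebesgue. q x \<bullet> G x + d x * ?v x) = integral ?T (\<lambda>x. q x \<bullet> G x + d x * ?v x)"
    by (intro set_lebesgue_integral_eq_integral(2) set_integral_add(1) absolutely_integrable_inner_continuous
      absolutely_integrable_times_continuous int cont compact_triangle)
  moreover have "integral ?T (\<lambda>x. q x \<bullet> G x + d x * ?v x) = integral ?T (\<lambda>x. c * ?v x)"
  proof -
    have "AE x in lebesgue. \<not> (x \<in> ?T \<and> (q x \<noteq> 0 \<or> d x \<noteq> c))"
      using q d by eventually_elim auto
    then obtain N where "negligible N" "{x. x \<in> ?T \<and> (q x \<noteq> 0 \<or> d x \<noteq> c)} \<subseteq> N"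
      unfolding eventually_ae_filter_negligible by auto
    then show ?thesis
      by (intro integral_spike[of N]) auto
  qed
  ultimately have "c * integral ?T ?v = 0" by simp
  \<comment> \<open>Otherwise the nonnegative bubble would vanish almost everywhere, yet it is
    positive on an open set that contains the barycentre.\<close>
  moreover have "integral ?T ?v \<noteq> 0"
  proof
    assume I: "integral ?T ?v = 0"
    have vint: "?v absolutely_integrable_on ?T"
      by (intro absolutely_integrable_continuous_compact cont compact_triangle)
    have "(LINT x|lebesgue. indicator ?T x *\<^sub>R ?v x) = 0"
      using set_lebesgue_integral_eq_integral(2)[OF vint] I by (simp add: set_lebesgue_integral_def)
    moreover have "0 \<le> indicator ?T x *\<^sub>R ?v x" for x
      using mem_triangle_iff[OF ne, of x] by (auto simp: indicator_def)
    ultimately have "AE x in lebesgue. indicator ?T x *\<^sub>R ?v x = 0"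
      using integral_nonneg_eq_0_iff_AE[of lebesgue "\<lambda>x. indicator ?T x *\<^sub>R ?v x"] vint
      by (simp add: set_integrable_def)
    then obtain N where N: "negligible N" "{x. indicator ?T x *\<^sub>R ?v x \<noteq> 0} \<subseteq> N"
      unfolding eventually_ae_filter_negligible by auto
    let ?U = "{x. 0 < bary X Y Z x} \<inter> {x. 0 < bary Y Z X x} \<inter> {x. 0 < bary Z X Y x}"
    have "?U \<subseteq> {x. indicator ?T x *\<^sub>R ?v x \<noteq> 0}"
    proof
      fix x assume x: "x \<in> ?U"
      then have "x \<in> ?T" unfolding mem_triangle_iff[OF ne] by simp
      then show "x \<in> {x. indicator ?T x *\<^sub>R ?v x \<noteq> 0}" using x by simp
    qed
    then have "negligible ?U"
      by (rule negligible_subset[OF N(1) subset_trans[OF _ N(2)]])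
    moreover have "open ?U"
      by (intro open_Int open_Collect_less) (rule continuous_on_bary continuous_on_const)+
    moreover have "(1/3) *\<^sub>R (X + Y + Z) \<in> ?U"
    proof -
      have "bary X Y Z ((1/3) *\<^sub>R (X + Y + Z)) = 1/3" if "orient X Y Z \<noteq> 0" for X Y Z
      proof -
        have "orient ((1/3) *\<^sub>R (X + Y + Z)) Y Z = orient X Y Z / 3"
          by (simp add: orient_def algebra_simps)
        then show ?thesis using that unfolding bary_def by (simp only:) simp
      qed
      from this[OF ne] this[OF r(1)] this[OF r(2)] show ?thesis
        by (simp add: add.commute add.left_commute)
    qed
    ultimately show False using open_not_negligible by blast
  qed
  ultimately show ?thesis by simp
qed

section \<open>Affine fields as combinations of Raviart-Thomas functions\<close>

lemma edge_normal_inner: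
  assumes "X \<noteq> Y"
  shows "dist X Y * (edge_normal X Y \<bullet> v) = (Y$2 - X$2) * v$1 - (Y$1 - X$1) * v$2"
  using assms by (simp add: edge_normal_def inner_vec_def sum_2 field_simps)

lemma edge_normal_orient:
  assumes "X \<noteq> Y"
  shows "dist X Y * (edge_normal X Y \<bullet> (w - X)) = - orient X Y w"
  unfolding edge_normal_inner[OF assms] by (simp add: orient_def algebra_simps)

lemma unit_normal_cases:
  assumes "X \<noteq> Y" "norm n = 1" "n \<bullet> (Y - X) = 0"
  shows "n = edge_normal X Y \<or> n = - edge_normal X Y"
proof -
  define w where "w = Y - X"
  define c where "c = n$1 * w$2 - n$2 * w$1"
  have D: "(dist X Y)\<^sup>2 = (w$1)\<^sup>2 + (w$2)\<^sup>2"
    unfolding w_def dist_commute[of X Y] dist_norm power2_norm_eq_inner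
    by (simp add: inner_vec_def sum_2 power2_eq_square algebra_simps)
  have o: "n$1 * w$1 + n$2 * w$2 = 0"
    using assms(3) by (simp add: w_def inner_vec_def sum_2)
  have u: "(n$1)\<^sup>2 + (n$2)\<^sup>2 = 1"
    using assms(2) by (simp add: norm_eq_sqrt_inner inner_vec_def sum_2 power2_eq_square)
  \<comment> \<open>Lagrange's identity: the squares of the cross and the dot product of
    \<open>n\<close> and \<open>w\<close> add up to the product of the squared lengths.\<close>
  have "c\<^sup>2 + (n$1 * w$1 + n$2 * w$2)\<^sup>2 = ((n$1)\<^sup>2 + (n$2)\<^sup>2) * ((w$1)\<^sup>2 + (w$2)\<^sup>2)"
    by (simp add: c_def power2_eq_square algebra_simps)
  then have "c\<^sup>2 = (dist X Y)\<^sup>2" unfolding o u D by simp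
  then have c: "c = dist X Y \<or> c = - dist X Y"
    by (simp add: power2_eq_iff)
  have "(dist X Y)\<^sup>2 * n$1 = c * w$2 + w$1 * (n$1 * w$1 + n$2 * w$2)"
    "(dist X Y)\<^sup>2 * n$2 = - (c * w$1) + w$2 * (n$1 * w$1 + n$2 * w$2)"
    unfolding D c_def by (simp_all add: power2_eq_square algebra_simps)
  then have "(dist X Y)\<^sup>2 * n$1 = c * w$2" "(dist X Y)\<^sup>2 * n$2 = - (c * w$1)"
    unfolding o by simp_all
  moreover have d: "dist X Y \<noteq> 0" using assms by simp
  ultimately have "n$1 = c * w$2 / (dist X Y)\<^sup>2" "n$2 = - (c * w$1) / (dist X Y)\<^sup>2"
    by (simp_all add: field_simps)
  then have "n = (c / dist X Y) *\<^sub>R edge_normal X Y"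
    by (simp add: edge_normal_def vec_eq_iff forall_2 w_def[symmetric] power2_eq_square)
  then show ?thesis
    using c d by auto
qed

text \<open>The orientation of an edge may select either of its normals. Both claims together decide
  the sign of the Raviart-Thomas function in each case.\<close>

lemma points_out_triangle:
  assumes "0 < orient X Y Z"
  shows "points_out (convex hull {X, Y, Z}) (closed_segment X Y) (edge_normal X Y)"
    and "\<not> points_out (convex hull {X, Y, Z}) (closed_segment X Y) (- edge_normal X Y)"
proof -
  let ?e = "edge_normal X Y"
  have ne: "orient X Y Z \<noteq> 0" and "X \<noteq> Y" using assms by auto
  then have d: "0 < dist X Y" by simp
  have e: "?e \<bullet> (w - X) = - orient X Y w / dist X Y" for w
    using edge_normal_orient[OF \<open>X \<noteq> Y\<close>, of w] d by (simp add: field_simps)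
  show "points_out (convex hull {X, Y, Z}) (closed_segment X Y) ?e"
    unfolding points_out_def
  proof (intro ballI)
    fix w x assume w: "w \<in> convex hull {X, Y, Z}" and x: "x \<in> closed_segment X Y"
    have "0 \<le> bary Z X Y w" using w ne by (simp add: mem_triangle_iff)
    then have "0 \<le> orient w X Y / orient X Y Z"
      by (simp only: bary_def orient_rotate[of X Y Z])
    then have "0 \<le> orient X Y w"
      using assms by (simp add: zero_le_divide_iff orient_rotate[of X Y w])
    then have "?e \<bullet> (w - X) \<le> 0" using d by (simp add: e)
    moreover obtain t where t: "x = (1 - t) *\<^sub>R X + t *\<^sub>R Y"
      using x unfolding in_segment by blast
    then have "x - X = t *\<^sub>R (Y - X)" by (simp add: algebra_simps)
    then have "?e \<bullet> (x - X) = 0" by (simp add: e)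
    ultimately show "?e \<bullet> (w - x) \<le> 0" by (simp add: inner_diff_right)
  qed
  have "0 < (- ?e) \<bullet> (Z - X)" using assms d by (simp add: e)
  moreover have "Z \<in> convex hull {X, Y, Z}" by (simp add: hull_inc)
  ultimately show "\<not> points_out (convex hull {X, Y, Z}) (closed_segment X Y) (- ?e)"
    unfolding points_out_def by (metis ends_in_segment(1) not_less)
qed

lemma opposite_vertex_triangle:
  assumes "orient X Y Z \<noteq> 0"
  shows "opposite_vertex (convex hull {X, Y, Z}) (closed_segment X Y) = Z"
proof -
  have "Z \<notin> closed_segment X Y"
  proof
    assume "Z \<in> closed_segment X Y"
    then obtain t where "Z = (1 - t) *\<^sub>R X + t *\<^sub>R Y" unfolding in_segment by blast
    then have "bary Z X Y Z = 0" using bary_affine[of Z X Y t X Y] by simp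
    then show False using assms orient_rotate[of X Y Z] by simp
  qed
  moreover have "V extreme_point_of convex hull {X, Y, Z} \<longleftrightarrow> V \<in> {X, Y, Z}" for V
    using assms extreme_point_of_convex_hull_affine_independent not_affine_dependent_triangle by blast
  ultimately show ?thesis
    unfolding opposite_vertex_def by (intro the_equality) auto
qed

lemma edge_orientationD:
  assumes "edge_orientation \<Omega> \<T> \<nu>" "b \<in> mesh_edges \<T>"
  shows "norm (\<nu> b) = 1" "x \<in> b \<Longrightarrow> y \<in> b \<Longrightarrow> \<nu> b \<bullet> (x - y) = 0"
  using assms unfolding edge_orientation_def by blast+

lemma mesh_edgesI: "T \<in> \<T> \<Longrightarrow> b edge_of T \<Longrightarrow> b \<in> mesh_edges \<T>"
  unfolding mesh_edges_def by blast

lemma mesh_triangleE: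
  assumes "triangular_mesh \<Omega> \<T>" "T \<in> \<T>"
  obtains X Y Z where "T = convex hull {X, Y, Z}" "0 < orient X Y Z"
proof -
  have "2 simplex T" using assms by (simp add: triangular_mesh_def)
  then show thesis using that simplex_triangleE by blast
qed

lemma finite_mesh_edges:
  assumes "triangular_mesh \<Omega> \<T>"
  shows "finite (mesh_edges \<T>)"
proof -
  have "finite {e. e edge_of T}" if "T \<in> \<T>" for T
  proof -
    obtain X Y Z where "T = convex hull {X, Y, Z}" "0 < orient X Y Z"
      using mesh_triangleE[OF assms \<open>T \<in> \<T>\<close>] .
    then have "{e. e edge_of T} = {closed_segment X Y, closed_segment Y Z, closed_segment Z X}"
      using edges_of_triangle[of X Y Z] by auto
    then show ?thesis by simp
  qed
  moreover have "mesh_edges \<T> = (\<Union>T\<in>\<T>. {e. e edge_of T})"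
    unfolding mesh_edges_def by blast
  moreover have "finite \<T>"
    using assms by (simp add: triangular_mesh_def triangulation_def)
  ultimately show ?thesis by simp
qed

lemma raviart_thomas_interior:
  assumes "triangular_mesh \<Omega> \<T>" "T \<in> \<T>" "x \<in> interior T"
  shows "raviart_thomas \<T> \<nu> b x = (if b edge_of T then
    ((if points_out T b (\<nu> b) then 1 else - 1) / (2 * measure lebesgue T)) *\<^sub>R (x - opposite_vertex T b) else 0)"
proof -
  have "T' = T" if "T' \<in> \<T>" "x \<in> interior T'" for T'
    using mesh_interiors_disjoint[of \<T> T T'] assms that unfolding triangular_mesh_def by blast
  note unique = this
  show ?thesis
  proof (cases "b edge_of T")
    case True
    then have "{T'. T' \<in> \<T> \<and> b edge_of T' \<and> x \<in> interior T'} = {T}"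
      using unique assms(2,3) by blast
    then show ?thesis using True unfolding raviart_thomas_def by (simp only: sum.empty sum.insert finite.emptyI empty_iff not_False_eq_True add_0_right if_True if_False)
  next
    case False
    then have "{T'. T' \<in> \<T> \<and> b edge_of T' \<and> x \<in> interior T'} = {}"
      using unique by blast
    then show ?thesis using False unfolding raviart_thomas_def by (simp only: sum.empty sum.insert finite.emptyI empty_iff not_False_eq_True add_0_right if_True if_False)
  qed
qed

text \<open>Mesh edges are bare sets of points without named endpoints; the diameter recovers their
  length.\<close>

lemma diameter_closed_segment:
  fixes a b :: "'a::real_normed_vector"
  shows "diameter (closed_segment a b) = dist a b"
proof (rule antisym)
  show "diameter (closed_segment a b) \<le> dist a b"
  proof (rule diameter_le)
    fix x y assume "x \<in> closed_segment a b" "y \<in> closed_segment a b"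
    then obtain s t where st: "0 \<le> s" "s \<le> 1" "0 \<le> t" "t \<le> 1"
      "x = (1 - s) *\<^sub>R a + s *\<^sub>R b" "y = (1 - t) *\<^sub>R a + t *\<^sub>R b"
      unfolding in_segment by blast
    have "x - y = (t - s) *\<^sub>R (a - b)" unfolding st(5,6) by (simp add: algebra_simps)
    then have "norm (x - y) = \<bar>t - s\<bar> * norm (a - b)" by simp
    also have "\<dots> \<le> 1 * norm (a - b)" using st by (intro mult_right_mono) auto
    finally show "norm (x - y) \<le> dist a b" by (simp add: dist_norm)
  qed simp
  show "dist a b \<le> diameter (closed_segment a b)"
    by (rule diameter_bounded_bound) (auto intro: compact_imp_bounded compact_segment)
qed

text \<open>The flux of the affine field \<open>F\<close> through \<open>b\<close>: its normal component is constant along \<open>b\<close>, hence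
  can be read off at an arbitrary point.\<close>

definition edge_coefficient :: "((real^2) set \<Rightarrow> real^2) \<Rightarrow> (real^2 \<Rightarrow> real^2) \<Rightarrow> (real^2) set \<Rightarrow> real" where
  "edge_coefficient \<nu> F b = diameter b * (\<nu> b \<bullet> F (SOME p. p \<in> b))"

lemma edge_coefficient_eq:
  assumes "edge_orientation \<Omega> \<T> \<nu>" "closed_segment X Y \<in> mesh_edges \<T>"
    and F: "\<And>x. F x = u + k *\<^sub>R x"
  shows "edge_coefficient \<nu> F (closed_segment X Y) = dist X Y * (\<nu> (closed_segment X Y) \<bullet> F X)"
proof -
  let ?b = "closed_segment X Y"
  define p where "p = (SOME p. p \<in> ?b)"
  have "p \<in> ?b" unfolding p_def by (rule someI[of _ X]) simp
  then have "\<nu> ?b \<bullet> (p - X) = 0"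
    using edge_orientationD(2)[OF assms(1,2)] by simp
  then have "\<nu> ?b \<bullet> F p = \<nu> ?b \<bullet> F X"
    by (simp add: F inner_add_right inner_diff_right)
  then show ?thesis
    unfolding edge_coefficient_def p_def[symmetric] by (simp add: dist_norm diameter_closed_segment)
qed

text \<open>Reversing the chosen normal changes the sign of the flux and of the basis function on
  this triangle. Their product depends only on the outward flux.\<close>

lemma raviart_thomas_edge_term:
  assumes mesh: "triangular_mesh \<Omega> \<T>" and \<nu>: "edge_orientation \<Omega> \<T> \<nu>"
    and T: "convex hull {X, Y, Z} \<in> \<T>" and pos: "0 < orient X Y Z"
    and x: "x \<in> interior (convex hull {X, Y, Z})" and F: "\<And>x. F x = u + k *\<^sub>R x"
  shows "edge_coefficient \<nu> F (closed_segment X Y) *\<^sub>R raviart_thomas \<T> \<nu> (closed_segment X Y) x =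
    (((Y$2 - X$2) * (F X)$1 - (Y$1 - X$1) * (F X)$2) / orient X Y Z) *\<^sub>R (x - Z)"
proof -
  let ?b = "closed_segment X Y" and ?T = "convex hull {X, Y, Z}"
  have "X \<noteq> Y" using pos by auto
  have b: "?b edge_of ?T" using edges_of_triangle[of X Y Z] pos by simp
  then have bm: "?b \<in> mesh_edges \<T>" using T mesh_edgesI by blast
  have m: "2 * measure lebesgue ?T = orient X Y Z"
    using pos by (simp add: measure_triangle)
  have o: "opposite_vertex ?T ?b = Z"
    using pos by (intro opposite_vertex_triangle) simp
  have "\<nu> ?b \<bullet> (Y - X) = 0" using edge_orientationD(2)[OF \<nu> bm] by simp
  then have "\<nu> ?b = edge_normal X Y \<or> \<nu> ?b = - edge_normal X Y"
    using unit_normal_cases[OF \<open>X \<noteq> Y\<close>] edge_orientationD(1)[OF \<nu> bm] by blast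
  then have "(if points_out ?T ?b (\<nu> ?b) then 1 else - 1) * (dist X Y * (\<nu> ?b \<bullet> F X)) =
      dist X Y * (edge_normal X Y \<bullet> F X)"
    using points_out_triangle[OF pos] by auto
  also have "\<dots> = (Y$2 - X$2) * (F X)$1 - (Y$1 - X$1) * (F X)$2"
    by (rule edge_normal_inner[OF \<open>X \<noteq> Y\<close>])
  finally have eq: "dist X Y * (\<nu> ?b \<bullet> F X) * ((if points_out ?T ?b (\<nu> ?b) then 1 else - 1) / orient X Y Z) =
      ((Y$2 - X$2) * (F X)$1 - (Y$1 - X$1) * (F X)$2) / orient X Y Z"
    by (simp only: times_divide_eq_right mult.commute)
  show ?thesis
    unfolding raviart_thomas_interior[OF mesh T x] edge_coefficient_eq[OF \<nu> bm F] m o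
    using b by (simp only: if_True scaleR_scaleR eq)
qed

text \<open>In a counterclockwise triangle the three weights are the outward fluxes of
  \<open>F\<close> through the edges. The fields \<open>u + k *\<^sub>R x\<close> form the
  lowest-order Raviart-Thomas space of the triangle, and this is their expansion in its
  basis.\<close>

lemma raviart_thomas_local_identity:
  fixes F :: "real^2 \<Rightarrow> real^2"
  assumes "\<And>x. F x = u + k *\<^sub>R x"
  shows "((Y$2 - X$2) * (F X)$1 - (Y$1 - X$1) * (F X)$2) *\<^sub>R (x - Z) +
    ((Z$2 - Y$2) * (F Y)$1 - (Z$1 - Y$1) * (F Y)$2) *\<^sub>R (x - X) +
    ((X$2 - Z$2) * (F Z)$1 - (X$1 - Z$1) * (F Z)$2) *\<^sub>R (x - Y) = orient X Y Z *\<^sub>R F x"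
  by (simp add: assms vec_eq_iff forall_2 orient_def algebra_simps)

lemma raviart_thomas_expansion:
  assumes mesh: "triangular_mesh \<Omega> \<T>" and \<nu>: "edge_orientation \<Omega> \<T> \<nu>"
    and "T \<in> \<T>" "x \<in> interior T" and F: "\<And>x. F x = u + k *\<^sub>R x"
  shows "(\<Sum>b\<in>mesh_edges \<T>. edge_coefficient \<nu> F b *\<^sub>R raviart_thomas \<T> \<nu> b x) = F x"
proof -
  obtain X Y Z where T: "T = convex hull {X, Y, Z}" and pos: "0 < orient X Y Z"
    using mesh_triangleE[OF mesh assms(3)] .
  have T2: "T = convex hull {Y, Z, X}" "T = convex hull {Z, X, Y}"
    by (simp_all add: T insert_commute)
  have o: "orient Y Z X = orient X Y Z" "orient Z X Y = orient X Y Z"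
    by (simp_all only: orient_rotate[of Y Z X] orient_rotate[of X Y Z])
  let ?E = "{closed_segment X Y, closed_segment Y Z, closed_segment Z X}"
  have ne: "X \<noteq> Y" "Y \<noteq> Z" "Z \<noteq> X" using pos by auto
  have E: "b edge_of T \<longleftrightarrow> b \<in> ?E" for b
    using edges_of_triangle[of X Y Z] pos by (simp add: T)
  let ?t = "\<lambda>b. edge_coefficient \<nu> F b *\<^sub>R raviart_thomas \<T> \<nu> b x"
  have "(\<Sum>b\<in>mesh_edges \<T>. ?t b) = (\<Sum>b\<in>?E. ?t b)"
  proof (rule sum.mono_neutral_right)
    show "finite (mesh_edges \<T>)" using mesh by (rule finite_mesh_edges)
    show "?E \<subseteq> mesh_edges \<T>" using mesh_edgesI[OF assms(3)] E by blast
    show "\<forall>b\<in>mesh_edges \<T> - ?E. ?t b = 0"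
      using raviart_thomas_interior[OF mesh assms(3,4)] E by simp
  qed
  also have "\<dots> = ?t (closed_segment X Y) + ?t (closed_segment Y Z) + ?t (closed_segment Z X)"
  proof -
    have "closed_segment X Y \<noteq> closed_segment Y Z" "closed_segment X Y \<noteq> closed_segment Z X"
      "closed_segment Y Z \<noteq> closed_segment Z X"
      using ne by (auto simp: closed_segment_eq doubleton_eq_iff)
    then show ?thesis by (simp add: add.assoc)
  qed
  also have "\<dots> = (1 / orient X Y Z) *\<^sub>R (orient X Y Z *\<^sub>R F x)"
    unfolding raviart_thomas_local_identity[OF F, symmetric]
      raviart_thomas_edge_term[OF mesh \<nu> assms(3)[unfolded T] pos assms(4)[unfolded T] F]
      raviart_thomas_edge_term[OF mesh \<nu> assms(3)[unfolded T2(1)] pos[folded o(1)] assms(4)[unfolded T2(1)] F]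
      raviart_thomas_edge_term[OF mesh \<nu> assms(3)[unfolded T2(2)] pos[folded o(2)] assms(4)[unfolded T2(2)] F] o
    by (simp add: scaleR_add_right)
  also have "\<dots> = F x" using pos by simp
  finally show ?thesis .
qed

lemma absolutely_integrable_raviart_thomas:
  assumes mesh: "triangular_mesh \<Omega> \<T>" and \<Omega>: "open \<Omega>" "convex \<Omega>" "bounded \<Omega>"
    and q: "q absolutely_integrable_on \<Omega>"
  shows "(\<lambda>x. raviart_thomas \<T> \<nu> b x \<bullet> q x) absolutely_integrable_on \<Omega>"
proof -
  let ?c = "\<lambda>T. (if points_out T b (\<nu> b) then 1 else - 1) / (2 * measure lebesgue T)"
  let ?I = "{T \<in> \<T>. b edge_of T}"
  have fin: "finite ?I"
    using mesh by (simp add: triangular_mesh_def triangulation_def)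
  have eq: "raviart_thomas \<T> \<nu> b x \<bullet> q x =
    (\<Sum>T\<in>?I. indicator (interior T) x *\<^sub>R (q x \<bullet> (?c T *\<^sub>R (x - opposite_vertex T b))))" for x
  proof -
    have "raviart_thomas \<T> \<nu> b x = (\<Sum>T\<in>?I. indicator (interior T) x *\<^sub>R (?c T *\<^sub>R (x - opposite_vertex T b)))"
      unfolding raviart_thomas_def
      by (rule sum.mono_neutral_cong_left) (use fin in \<open>auto simp: indicator_def\<close>)
    then show ?thesis
      by (simp only: inner_sum_left inner_scaleR_left inner_scaleR_right real_scaleR_def inner_commute[of "q x"])
  qed
  have c\<Omega>: "compact (closure \<Omega>)" using \<Omega> by (simp add: compact_closure)
  have piece: "(\<lambda>x. indicator (interior T) x *\<^sub>R (q x \<bullet> w x)) absolutely_integrable_on \<Omega>"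
    if "continuous_on UNIV w" for T w
  proof -
    have "(\<lambda>x. q x \<bullet> w x) absolutely_integrable_on closure \<Omega>"
      using \<Omega> q c\<Omega> that by (intro absolutely_integrable_inner_continuous
        absolutely_integrable_on_closure_subset[where \<Omega> = \<Omega> and T = "closure \<Omega>"])
       (auto intro: continuous_on_subset)
    then have "(\<lambda>x. q x \<bullet> w x) absolutely_integrable_on (\<Omega> \<inter> interior T)"
      using \<Omega>(1) closure_subset by (elim set_integrable_subset) auto
    then show ?thesis
      unfolding set_integrable_def by (simp add: indicator_inter_arith mult.assoc)
  qed
  show ?thesis
    unfolding eq by (intro absolutely_integrable_sum fin piece continuous_intros)
qed

text \<open>The pointwise expansion is available inside the triangles, and the finitely many
  frontiers form a null set.\<close>

lemma L2_inner_affine: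
  assumes mesh: "triangular_mesh \<Omega> \<T>" and \<nu>: "edge_orientation \<Omega> \<T> \<nu>"
    and \<Omega>: "open \<Omega>" "convex \<Omega>" "bounded \<Omega>" "interior (closure \<Omega>) = \<Omega>"
    and q: "q absolutely_integrable_on \<Omega>"
    and F: "\<And>x. F x = u + k *\<^sub>R x"
  shows "integral \<Omega> (\<lambda>x. F x \<bullet> q x) =
    (\<Sum>b\<in>mesh_edges \<T>. edge_coefficient \<nu> F b * L2_inner \<Omega> (raviart_thomas \<T> \<nu> b) q)"
proof -
  let ?\<phi> = "raviart_thomas \<T> \<nu>" and ?c = "edge_coefficient \<nu> F"
  have int: "(\<lambda>x. ?\<phi> b x \<bullet> q x) absolutely_integrable_on \<Omega>" for b
    using mesh \<Omega>(1-3) q by (rule absolutely_integrable_raviart_thomas)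
  let ?N = "\<Union>T\<in>\<T>. frontier T"
  have "negligible ?N"
  proof (rule negligible_Union)
    show "finite (frontier ` \<T>)"
      using mesh by (simp add: triangular_mesh_def triangulation_def)
    show "negligible t" if "t \<in> frontier ` \<T>" for t
      using that mesh negligible_convex_frontier convex_simplex
      by (auto simp: triangular_mesh_def)
  qed
  moreover have "F x \<bullet> q x = (\<Sum>b\<in>mesh_edges \<T>. ?c b * (?\<phi> b x \<bullet> q x))" if x: "x \<in> \<Omega> - ?N" for x
  proof -
    have "x \<in> \<Union>\<T>"
      using x closure_subset[of \<Omega>] mesh unfolding triangular_mesh_def by blast
    then obtain T where T: "T \<in> \<T>" "x \<in> T" by blast
    then have "x \<in> interior T"
      using x closure_subset[of T] unfolding frontier_def by blast
    then have "F x = (\<Sum>b\<in>mesh_edges \<T>. ?c b *\<^sub>R ?\<phi> b x)"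
      using raviart_thomas_expansion[OF mesh \<nu> T(1) _ F] by simp
    then show ?thesis by (simp add: inner_sum_left)
  qed
  ultimately have "integral \<Omega> (\<lambda>x. F x \<bullet> q x) =
      integral \<Omega> (\<lambda>x. \<Sum>b\<in>mesh_edges \<T>. ?c b * (?\<phi> b x \<bullet> q x))"
    by (intro integral_spike[of ?N]) auto
  also have "\<dots> = (\<Sum>b\<in>mesh_edges \<T>. integral \<Omega> (\<lambda>x. ?c b * (?\<phi> b x \<bullet> q x)))"
    using int by (intro integral_sum finite_mesh_edges[OF mesh] set_lebesgue_integral_eq_integral(1))
      (auto intro: set_integrable_mult_right)
  also have "\<dots> = (\<Sum>b\<in>mesh_edges \<T>. ?c b * L2_inner \<Omega> (?\<phi> b) q)"
    using set_lebesgue_integral_eq_integral(2)[OF int] by (simp add: L2_inner_def)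
  finally show ?thesis .
qed

section \<open>Fluxes of a field with piecewise constant divergence\<close>

text \<open>Adjacent counterclockwise triangles traverse their common edge in opposite directions,
  whereas an arc length integral is invariant under \<open>t \<mapsto> 1 - t\<close>.\<close>

lemma edge_integral_commute:
  assumes "edge_integrable X Y f" "edge_integrable Y X f"
  shows "edge_integral Y X f = edge_integral X Y f"
proof -
  let ?h = "\<lambda>t. f (linepath X Y t)"
  have h: "?h absolutely_integrable_on {0..1}" "(\<lambda>t. f (linepath Y X t)) absolutely_integrable_on {0..1}"
    using assms by (simp_all add: edge_integrable_def)
  have "(?h has_integral integral {0..1} ?h) (cbox 0 1)"
    using set_lebesgue_integral_eq_integral(1)[OF h(1)] by (simp add: integrable_integral)
  from has_integral_affinity[OF this, of "-1" 1]
  have "((\<lambda>t. ?h (1 - t)) has_integral integral {0..1} ?h) ((\<lambda>t. 1 - t) ` {0..1})"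
    by simp
  moreover have "(\<lambda>t. 1 - t) ` {0..1} = {0..1::real}"
    by (auto simp: image_iff intro!: bexI[of _ "1 - _"])
  moreover have "?h (1 - t) = f (linepath Y X t)" for t
    by (simp add: linepath_def add.commute)
  ultimately have "integral {0..1} (\<lambda>t. f (linepath Y X t)) = integral {0..1} ?h"
    by (simp add: integral_unique)
  then show ?thesis
    unfolding edge_integral_def by (simp add: set_lebesgue_integral_eq_integral(2)[OF h(1)]
      set_lebesgue_integral_eq_integral(2)[OF h(2)] dist_commute)
qed

lemma triangles_distinct:
  assumes "triangular_mesh \<Omega> \<T>" "convex hull {X, Y, Z} \<in> \<T>" "convex hull {X', Y', Z'} \<in> \<T>"
    and "V \<in> {X, Y, Z}" "V \<notin> {X', Y', Z'}"
  shows "convex hull {X, Y, Z} \<noteq> convex hull {X', Y', Z'}"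
  using assms triangle_vertices_unique mesh_simplexD by metis

locale mesh_field =
  fixes \<Omega> :: "(real^2) set" and \<T> :: "(real^2) set set"
    and q :: "real^2 \<Rightarrow> real^2" and g :: "(real^2) set \<Rightarrow> real^2 \<Rightarrow> real"
  assumes domain: "convex_polygonal_domain \<Omega>"
    and mesh: "triangular_mesh \<Omega> \<T>"
    and Hdiv: "q \<in> Hdiv \<Omega>"
    and traces: "has_normal_traces \<Omega> \<T> q g"
    and div_const: "\<And>T. T \<in> \<T> \<Longrightarrow> \<exists>c. AE x in lebesgue. x \<in> T \<longrightarrow> divergence \<Omega> q x = c"
begin

lemma \<Omega>: "open \<Omega>" "convex \<Omega>" "bounded \<Omega>" "interior (closure \<Omega>) = \<Omega>"
  using domain domain_interior_closure[OF domain] by (simp_all add: convex_polygonal_domain_def)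

lemma weak_divergence: "L2_on \<Omega> (divergence \<Omega> q)" "has_weak_divergence \<Omega> q (divergence \<Omega> q)"
proof -
  have "\<exists>d. L2_on \<Omega> d \<and> has_weak_divergence \<Omega> q d"
    using Hdiv unfolding Hdiv_def by blast
  from someI_ex[OF this] show "L2_on \<Omega> (divergence \<Omega> q)" "has_weak_divergence \<Omega> q (divergence \<Omega> q)"
    unfolding divergence_def by blast+
qed

lemma integrable_domain: "q absolutely_integrable_on \<Omega>" "divergence \<Omega> q absolutely_integrable_on \<Omega>"
proof -
  have "L2_on \<Omega> q" using Hdiv unfolding Hdiv_def by blast
  then show "q absolutely_integrable_on \<Omega>"
    using \<Omega> L2_on_absolutely_integrable by blast
  show "divergence \<Omega> q absolutely_integrable_on \<Omega>"
    using \<Omega> L2_on_absolutely_integrable weak_divergence(1) by blast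
qed

lemma integrable_triangle:
  assumes "convex hull {X, Y, Z} \<in> \<T>"
  shows "q absolutely_integrable_on convex hull {X, Y, Z}"
    "divergence \<Omega> q absolutely_integrable_on convex hull {X, Y, Z}"
  using absolutely_integrable_on_closure_subset[OF integrable_domain(1) \<Omega>(1,2) compact_triangle mesh_subset_closure[OF mesh assms]]
    absolutely_integrable_on_closure_subset[OF integrable_domain(2) \<Omega>(1,2) compact_triangle mesh_subset_closure[OF mesh assms]] .

lemma opposite_orientation:
  assumes "convex hull {X, Y, Z} \<in> \<T>" "0 < orient X Y Z" "convex hull {X, Y, V} \<in> \<T>"
    and "convex hull {X, Y, V} \<noteq> convex hull {X, Y, Z}"
  shows "orient X Y V < 0"
proof (rule opposite_sides[OF assms(2)])
  show "orient X Y V \<noteq> 0" using mesh assms(3) by (rule mesh_simplexD)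
  show "interior (convex hull {X, Y, Z}) \<inter> interior (convex hull {X, Y, V}) = {}"
    using mesh mesh_interiors_disjoint assms unfolding triangular_mesh_def by metis
qed

text \<open>The trace on the second triangle is left arbitrary so that the zero function can be used
  beyond the support.\<close>

lemma flux_balance_mesh:
  assumes T: "convex hull {X, Y, Z} \<in> \<T>" "0 < orient X Y Z" "convex hull {X, Y, V} \<in> \<T>"
    "convex hull {X, Y, V} \<noteq> convex hull {X, Y, Z}"
    and green: "green_formula q (divergence \<Omega> q) g' X Y V"
    and v: "C1_with_gradient v G"
  shows "edge_integral X Y (\<lambda>x. g (convex hull {X, Y, Z}) x * v x) = - edge_integral X Y (\<lambda>x. g' x * v x)"
  using \<Omega> integrable_domain weak_divergence(2) mesh_subset_closure[OF mesh T(1)] mesh_subset_closure[OF mesh T(3)]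
    T(2) opposite_orientation[OF T] mesh_inter_negligible[OF mesh T(1) T(3)] T(4)
    has_normal_traces_green[OF traces T(1)] green v
  by (intro flux_balance[of \<Omega> q "divergence \<Omega> q"]) auto

lemma inner_flux:
  assumes T: "convex hull {X, Y, Z} \<in> \<T>" "0 < orient X Y Z" "convex hull {X, Y, V} \<in> \<T>"
    "convex hull {X, Y, V} \<noteq> convex hull {X, Y, Z}"
    and v: "C1_with_gradient v G"
  shows "edge_integral Y X (\<lambda>x. g (convex hull {X, Y, V}) x * v x) =
    - edge_integral X Y (\<lambda>x. g (convex hull {X, Y, Z}) x * v x)"
proof -
  have "convex hull {Y, X, V} \<in> \<T>" "convex hull {Y, X, V} = convex hull {X, Y, V}"
    using T by (simp_all add: insert_commute)
  then have "edge_integrable X Y (g (convex hull {X, Y, V}))" "edge_integrable Y X (g (convex hull {X, Y, V}))"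
    using traces T(3) unfolding has_normal_traces_def by metis+
  then have "edge_integrable X Y (\<lambda>x. g (convex hull {X, Y, V}) x * v x)"
    "edge_integrable Y X (\<lambda>x. g (convex hull {X, Y, V}) x * v x)"
    using edge_integrable_times[OF _ C1_with_gradient_continuous(1)[OF v]]
    unfolding edge_integrable_def by blast+
  then show ?thesis
    using flux_balance_mesh[OF T has_normal_traces_green[OF traces T(3)] v] edge_integral_commute by simp
qed

text \<open>If the edge is not on the boundary of the domain, the triangle beyond it is outside
  \<open>\<S>\<close>. There the field is zero almost everywhere, its constant divergence is zero,
  and 0 is an admissible trace; balance across the edge carries this to the trace on the near
  side.\<close>

lemma outer_flux:
  assumes T: "convex hull {X, Y, Z} \<in> \<T>" "0 < orient X Y Z"
    and boundary: "closed_segment X Y \<subseteq> frontier \<Omega> \<Longrightarrow>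
      AE t in lebesgue. t \<in> {0..1} \<longrightarrow> g (convex hull {X, Y, Z}) (linepath X Y t) = 0"
    and S: "finite \<S>" "\<S> \<subseteq> \<T>"
    and support: "AE x in lebesgue. x \<in> \<Omega> \<longrightarrow> x \<notin> \<Union>\<S> \<longrightarrow> q x = 0"
    and others: "\<And>V. convex hull {X, Y, V} \<in> \<S> \<Longrightarrow> convex hull {X, Y, V} = convex hull {X, Y, Z}"
    and v: "C1_with_gradient v G"
  shows "edge_integral X Y (\<lambda>x. g (convex hull {X, Y, Z}) x * v x) = 0"
proof (cases "closed_segment X Y \<subseteq> frontier \<Omega>")
  case True
  have "AE t in lebesgue. t \<in> {0..1} \<longrightarrow> g (convex hull {X, Y, Z}) (linepath X Y t) * v (linepath X Y t) = 0"
    using boundary[OF True] by eventually_elim auto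
  then show ?thesis by (rule edge_integral_eq_0)
next
  case False
  then obtain V where V: "convex hull {X, Y, V} \<in> \<T>" "convex hull {X, Y, V} \<noteq> convex hull {X, Y, Z}"
    using mesh_neighbour[OF domain mesh T(1)] by blast
  let ?T = "convex hull {X, Y, V}"
  have "?T \<notin> \<S>" using others V by blast
  have q: "AE x in lebesgue. x \<in> ?T \<longrightarrow> q x = 0"
  proof -
    \<comment> \<open>The support condition speaks only of points of the domain off the closed
      triangles of \<open>\<S>\<close>; what it misses in \<open>?T\<close> is contained in this
      null set together with the frontier.\<close>
    have "negligible (\<Union>((\<lambda>T'. ?T \<inter> T') ` \<S>))"
      using S V \<open>?T \<notin> \<S>\<close> by (intro negligible_Union) (auto intro: mesh_inter_negligible[OF mesh])
    moreover have "negligible (frontier \<Omega>)"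
      using \<Omega> by (intro negligible_convex_frontier)
    ultimately have "negligible (frontier \<Omega> \<union> \<Union>((\<lambda>T'. ?T \<inter> T') ` \<S>))" (is "negligible ?N")
      by (rule negligible_Un[rotated])
    then have "AE x in lebesgue. x \<notin> ?N"
      unfolding eventually_ae_filter_negligible by (intro exI[of _ ?N]) blast
    then show ?thesis
      using support
    proof eventually_elim
      case (elim x)
      then show ?case
        using mesh_subset_closure[OF mesh V(1)] \<Omega>(1) by (auto simp: frontier_def interior_open)
    qed
  qed
  obtain c where c: "AE x in lebesgue. x \<in> ?T \<longrightarrow> divergence \<Omega> q x = c"
    using div_const[OF V(1)] by blast
  have "c = 0"
    using divergence_constant_zero[OF mesh_simplexD[OF mesh V(1)] has_normal_traces_green[OF traces V(1)] q c
        integrable_triangle[OF V(1)]] .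
  then have "green_formula q (divergence \<Omega> q) (\<lambda>_. 0) X Y V"
    using q c by (intro green_formula_zero) simp_all
  from flux_balance_mesh[OF T V this v] show ?thesis
    by (simp add: edge_integral_def)
qed

lemma green_integral:
  assumes T: "convex hull {X, Y, Z} \<in> \<T>"
    and c: "AE x in lebesgue. x \<in> convex hull {X, Y, Z} \<longrightarrow> divergence \<Omega> q x = c"
    and v: "C1_with_gradient v G"
  shows "integral (convex hull {X, Y, Z}) (\<lambda>x. G x \<bullet> q x) + c * integral (convex hull {X, Y, Z}) v =
    edge_integral X Y (\<lambda>x. g (convex hull {X, Y, Z}) x * v x) +
    edge_integral Y Z (\<lambda>x. g (convex hull {X, Y, Z}) x * v x) +
    edge_integral Z X (\<lambda>x. g (convex hull {X, Y, Z}) x * v x)"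
proof -
  let ?T = "convex hull {X, Y, Z}"
  note cont = C1_with_gradient_continuous[OF v]
  have i: "(\<lambda>x. q x \<bullet> G x) absolutely_integrable_on ?T" "(\<lambda>x. divergence \<Omega> q x * v x) absolutely_integrable_on ?T"
    by (intro absolutely_integrable_inner_continuous absolutely_integrable_times_continuous
        integrable_triangle T cont compact_triangle)+
  obtain N where "negligible N" "{x. \<not> (x \<in> ?T \<longrightarrow> divergence \<Omega> q x = c)} \<subseteq> N"
    using c unfolding eventually_ae_filter_negligible by blast
  then have "integral ?T (\<lambda>x. divergence \<Omega> q x * v x) = integral ?T (\<lambda>x. c * v x)"
    by (intro integral_spike[of N]) auto
  moreover have "(LINT x:?T|lebesgue. q x \<bullet> G x + divergence \<Omega> q x * v x) =
      integral ?T (\<lambda>x. G x \<bullet> q x) + integral ?T (\<lambda>x. divergence \<Omega> q x * v x)"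
    unfolding set_integral_add(2)[OF i] using i
    by (simp add: set_lebesgue_integral_eq_integral(2) inner_commute)
  ultimately show ?thesis
    using has_normal_traces_green[OF traces T] v unfolding green_formula_def by auto
qed

end

text \<open>Vectors start at the midpoint of \<open>[S,N]\<close>, so \<open>n\<close> stands for
  \<open>N\<close> and \<open>- n\<close> for \<open>S\<close>. Bringing
  \<open>V \<bullet> (e + w)\<close> to the left and expanding it by \<open>A\<close> gives \<alpha>
  the coefficient \<open>(a + n) \<bullet> (a + e) / 3\<close> and \<eta> the coefficient
  \<open>(e \<bullet> e - w \<bullet> w) / 3\<close>, with analogous ones for the others. The left
  side of \<open>B\<close> is -6 times this sum.\<close>

lemma flux_algebra:
  fixes n w e a b c d V :: "'a::real_inner"
  assumes A: "\<eta> *\<^sub>R ((1/3) *\<^sub>R (e - w)) + \<alpha> *\<^sub>R ((1/3) *\<^sub>R (a + n)) + \<beta> *\<^sub>R ((1/3) *\<^sub>R (b + n)) +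
      \<gamma> *\<^sub>R ((1/3) *\<^sub>R (c - n)) + \<delta> *\<^sub>R ((1/3) *\<^sub>R (d - n)) = V"
    and B: "(\<eta> + \<beta> + \<gamma>) * (n \<bullet> n + n \<bullet> n + w \<bullet> w + w \<bullet> w) +
      (- \<eta> + \<delta> + \<alpha>) * (n \<bullet> n + n \<bullet> n + e \<bullet> e + e \<bullet> e) -
      \<alpha> * (n \<bullet> n + e \<bullet> e + a \<bullet> a + (n + e + a) \<bullet> (n + e + a)) -
      \<beta> * (w \<bullet> w + n \<bullet> n + b \<bullet> b + (w + n + b) \<bullet> (w + n + b)) -
      \<gamma> * (n \<bullet> n + w \<bullet> w + c \<bullet> c + (w + c - n) \<bullet> (w + c - n)) -
      \<delta> * (e \<bullet> e + n \<bullet> n + d \<bullet> d + (e + d - n) \<bullet> (e + d - n)) = 0"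
  shows "\<alpha> * (((1/3) *\<^sub>R (a + n)) \<bullet> (a - w)) + \<beta> * (((1/3) *\<^sub>R (b + n)) \<bullet> (b - e)) +
      \<gamma> * (((1/3) *\<^sub>R (c - n)) \<bullet> (c - e)) + \<delta> * (((1/3) *\<^sub>R (d - n)) \<bullet> (d - w)) = - (V \<bullet> (e + w))"
  using B unfolding A[symmetric]
  by (simp add: inner_add_left inner_add_right inner_diff_left inner_diff_right inner_commute field_simps)

theorem theorem2:
  fixes \<Omega> :: "(real^2) set" and \<T> :: "(real^2) set set"
    and \<nu> :: "(real^2) set \<Rightarrow> real^2"
    and \<phi>s :: "(real^2) set \<Rightarrow> real^2 \<Rightarrow> real^2"
    and g :: "(real^2) set \<Rightarrow> real^2 \<Rightarrow> real"
    and S N W E A B C D K_c L_c M_c P_c Q_c R_c mid :: "real^2"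
    and K L M P Q R :: "(real^2) set"
    and \<eta> \<alpha> \<beta> \<gamma> \<delta> :: real
  assumes "K = convex hull {S, N, W}" and "L = convex hull {N, S, E}"
    and "M = convex hull {N, E, A}" and "P = convex hull {W, N, B}"
    and "Q = convex hull {S, W, C}" and "R = convex hull {E, S, D}"
    and "K_c = barycentre S N W" and "L_c = barycentre N S E"
    and "M_c = barycentre N E A" and "P_c = barycentre W N B"
    and "Q_c = barycentre S W C" and "R_c = barycentre E S D"
    and "mid = midpoint S N"
    and "\<eta> = edge_integral S N (g K)"
    and "\<alpha> = edge_integral E N (g L)"
    and "\<beta> = edge_integral N W (g K)"
    and "\<gamma> = edge_integral W S (g K)"
    and "\<delta> = edge_integral S E (g L)"
    and domain: "convex_polygonal_domain \<Omega>"
    and mesh: "triangular_mesh \<Omega> \<T>"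
    and orientation: "edge_orientation \<Omega> \<T> \<nu>"
    and neighbourhood: "edge_neighbourhood \<T> S N W E A B C D"
    and orientation_SN: "\<nu> (closed_segment S N) = edge_normal S N"
    and dual: "dual_basis_hypothesis \<Omega> \<T> \<nu> \<phi>s"
    and traces: "has_normal_traces \<Omega> \<T> (\<phi>s (closed_segment S N)) g"
    \<comment> \<open>no flux leaves the support through the boundary of the domain;
        vacuous when no edge of \<open>M\<close>, \<open>P\<close>, \<open>Q\<close>, \<open>R\<close> lies on that boundary\<close>
    and boundary: "\<And>T X Y. T \<in> {M, P, Q, R} \<Longrightarrow> closed_segment X Y edge_of T \<Longrightarrow>
        closed_segment X Y \<subseteq> frontier \<Omega> \<Longrightarrow>
        (AE t in lebesgue. t \<in> {0..1} \<longrightarrow> g T (linepath X Y t) = 0)"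
  shows "\<eta> *\<^sub>R (L_c - K_c) + \<alpha> *\<^sub>R (M_c - L_c) + \<beta> *\<^sub>R (P_c - K_c) +
           \<gamma> *\<^sub>R (Q_c - K_c) + \<delta> *\<^sub>R (R_c - L_c) = dist S N *\<^sub>R edge_normal S N \<and>
         \<alpha> * ((M_c - L_c) \<bullet> (A - W)) + \<beta> * ((P_c - K_c) \<bullet> (B - E)) +
           \<gamma> * ((Q_c - K_c) \<bullet> (C - E)) + \<delta> * ((R_c - L_c) \<bullet> (D - W)) =
         - 3 * dist S N * (edge_normal S N \<bullet> ((L_c - mid) + (K_c - mid)))"
proof -
  note defs = assms(1-18)
  let ?a = "closed_segment S N" and ?e = "edge_normal S N"
  let ?q = "\<phi>s ?a"

  \<comment> \<open>Position of the six triangles\<close>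
  have dist: "distinct [S, N, W, E, A, B, C, D]"
    and in_mesh: "K \<in> \<T>" "L \<in> \<T>" "M \<in> \<T>" "P \<in> \<T>" "Q \<in> \<T>" "R \<in> \<T>"
    and out: "points_out K ?a ?e" "points_out L ?a (- ?e)"
    using neighbourhood unfolding edge_neighbourhood_def defs by blast+
  \<comment> \<open>The reversed list supplies every inequality of two vertices in the other
    direction.\<close>
  have dist_rev: "distinct [D, C, B, A, E, W, N, S]"
    using dist distinct_rev[of "[S, N, W, E, A, B, C, D]"] by simp
  have "S \<noteq> N" using dist by simp
  \<comment> \<open>The edge lemmas read the edge off the first two vertices, so each triangle is
    recorded in every listing in which it will be used.\<close>
  have K_in: "convex hull {S, N, W} \<in> \<T>" "convex hull {N, W, S} \<in> \<T>" "convex hull {W, S, N} \<in> \<T>"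
    and K_eq: "convex hull {S, N, W} = K" "convex hull {N, W, S} = K" "convex hull {W, S, N} = K"
    and L_in: "convex hull {N, S, E} \<in> \<T>" "convex hull {S, N, E} \<in> \<T>" "convex hull {S, E, N} \<in> \<T>"
      "convex hull {E, N, S} \<in> \<T>"
    and L_eq: "convex hull {N, S, E} = L" "convex hull {S, N, E} = L" "convex hull {S, E, N} = L"
      "convex hull {E, N, S} = L"
    using in_mesh by (simp_all add: defs insert_commute)
  have M_in: "convex hull {N, E, A} \<in> \<T>" "convex hull {E, N, A} \<in> \<T>" "convex hull {E, A, N} \<in> \<T>" "convex hull {A, N, E} \<in> \<T>"
    and M_eq: "convex hull {N, E, A} = M" "convex hull {E, N, A} = M" "convex hull {E, A, N} = M" "convex hull {A, N, E} = M"
    and P_in: "convex hull {W, N, B} \<in> \<T>" "convex hull {N, W, B} \<in> \<T>" "convex hull {N, B, W} \<in> \<T>" "convex hull {B, W, N} \<in> \<T>"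
    and P_eq: "convex hull {W, N, B} = P" "convex hull {N, W, B} = P" "convex hull {N, B, W} = P" "convex hull {B, W, N} = P"
    and Q_in: "convex hull {S, W, C} \<in> \<T>" "convex hull {W, S, C} \<in> \<T>" "convex hull {W, C, S} \<in> \<T>" "convex hull {C, S, W} \<in> \<T>"
    and Q_eq: "convex hull {S, W, C} = Q" "convex hull {W, S, C} = Q" "convex hull {W, C, S} = Q" "convex hull {C, S, W} = Q"
    and R_in: "convex hull {E, S, D} \<in> \<T>" "convex hull {S, E, D} \<in> \<T>" "convex hull {S, D, E} \<in> \<T>" "convex hull {D, E, S} \<in> \<T>"
    and R_eq: "convex hull {E, S, D} = R" "convex hull {S, E, D} = R" "convex hull {S, D, E} = R" "convex hull {D, E, S} = R"
    using in_mesh by (simp_all add: defs insert_commute)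
  note ins = K_in L_in M_in P_in Q_in R_in and eqs = K_eq L_eq M_eq P_eq Q_eq R_eq
  note nz = ins[THEN mesh_simplexD[OF mesh]]
  have a_edge: "?a edge_of K"
    using edges_of_triangle[OF nz(1)] by (simp add: defs)
  then have a_mesh: "?a \<in> mesh_edges \<T>"
    using in_mesh mesh_edgesI by blast
  interpret mesh_field \<Omega> \<T> ?q g
  proof
    show "\<exists>c. AE x in lebesgue. x \<in> T \<longrightarrow> divergence \<Omega> ?q x = c" if "T \<in> \<T>" for T
      using dual a_mesh that unfolding dual_basis_hypothesis_def by blast
    show "?q \<in> Hdiv \<Omega>"
      using dual a_mesh unfolding dual_basis_hypothesis_def by blast
  qed (fact domain mesh traces)+

  have d: "0 < dist S N" using \<open>S \<noteq> N\<close> by simp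
  \<comment> \<open>The normal condition gives only a weak inequality; nondegeneracy of the triangle
    makes it strict.\<close>
  have orient_K: "0 < orient S N W"
  proof -
    have "?e \<bullet> (W - S) \<le> 0"
      using out(1) unfolding points_out_def defs by (simp add: hull_inc)
    then have "dist S N * (?e \<bullet> (W - S)) \<le> 0" using d by (simp add: mult_le_0_iff)
    then show ?thesis
      using nz(1) unfolding edge_normal_orient[OF \<open>S \<noteq> N\<close>] by simp
  qed
  have orient_L: "0 < orient N S E"
  proof -
    have "0 \<le> ?e \<bullet> (E - S)"
      using out(2) unfolding points_out_def defs by (simp add: hull_inc)
    then have "0 \<le> dist S N * (?e \<bullet> (E - S))" using d by simp
    then show ?thesis
      using nz(4) orient_swap[of N S E] unfolding edge_normal_orient[OF \<open>S \<noteq> N\<close>] by simp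
  qed
  have oK: "0 < orient S N W" "0 < orient N W S" "0 < orient W S N"
    using orient_K orient_rotate[of N W S] orient_rotate[of S N W] by simp_all
  have oL: "0 < orient N S E" "0 < orient S E N" "0 < orient E N S"
    using orient_L orient_rotate[of S E N] orient_rotate[of N S E] by simp_all
  \<comment> \<open>In each pair one triangle has a vertex that the other lacks.\<close>
  have neq: "L \<noteq> K" "M \<noteq> K" "P \<noteq> K" "Q \<noteq> K" "R \<noteq> K" "M \<noteq> L" "P \<noteq> L" "Q \<noteq> L" "R \<noteq> L"
    "P \<noteq> M" "Q \<noteq> M" "R \<noteq> M" "Q \<noteq> P" "R \<noteq> P" "R \<noteq> Q"
    using dist dist_rev triangles_distinct[OF mesh L_in(1) K_in(1), of E]
      triangles_distinct[OF mesh M_in(1) K_in(1), of A]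
      triangles_distinct[OF mesh P_in(1) K_in(1), of B]
      triangles_distinct[OF mesh Q_in(1) K_in(1), of C]
      triangles_distinct[OF mesh R_in(1) K_in(1), of D]
      triangles_distinct[OF mesh M_in(1) L_in(1), of A]
      triangles_distinct[OF mesh P_in(1) L_in(1), of B]
      triangles_distinct[OF mesh Q_in(1) L_in(1), of C]
      triangles_distinct[OF mesh R_in(1) L_in(1), of D]
      triangles_distinct[OF mesh P_in(1) M_in(1), of B]
      triangles_distinct[OF mesh Q_in(1) M_in(1), of C]
      triangles_distinct[OF mesh R_in(1) M_in(1), of D]
      triangles_distinct[OF mesh Q_in(1) P_in(1), of C]
      triangles_distinct[OF mesh R_in(1) P_in(1), of D]
      triangles_distinct[OF mesh R_in(1) Q_in(1), of D]
    unfolding eqs by simp_all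

  \<comment> \<open>A triangle across an edge of \<open>K\<close> or \<open>L\<close> lies on the
    opposite side, so it is counterclockwise when that edge is listed backwards.\<close>
  have oM: "0 < orient N E A" "0 < orient E A N" "0 < orient A N E"
    using opposite_orientation[of E N S A] oL ins neq orient_swap[of N E A] orient_rotate[of E A N] orient_rotate[of N E A]
    by (simp_all add: eqs)
  have oP: "0 < orient W N B" "0 < orient N B W" "0 < orient B W N"
    using opposite_orientation[of N W S B] oK ins neq orient_swap[of W N B] orient_rotate[of N B W] orient_rotate[of W N B]
    by (simp_all add: eqs)
  have oQ: "0 < orient S W C" "0 < orient W C S" "0 < orient C S W"
    using opposite_orientation[of W S N C] oK ins neq orient_swap[of S W C] orient_rotate[of W C S] orient_rotate[of S W C]
    by (simp_all add: eqs)
  have oR: "0 < orient E S D" "0 < orient S D E" "0 < orient D E S"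
    using opposite_orientation[of S E N D] oL ins neq orient_swap[of E S D] orient_rotate[of S D E] orient_rotate[of E S D]
    by (simp_all add: eqs)

  let ?S = "{K, L, M, P, Q, R}"
  have support: "AE x in lebesgue. x \<in> \<Omega> \<longrightarrow> x \<notin> \<Union>?S \<longrightarrow> ?q x = 0"
  proof -
    have "AE x in lebesgue. x \<in> \<Omega> \<longrightarrow> x \<notin> K \<union> L \<union> M \<union> P \<union> Q \<union> R \<longrightarrow> ?q x = 0"
      using dual neighbourhood unfolding dual_basis_hypothesis_def defs by blast
    then show ?thesis by eventually_elim auto
  qed

  \<comment> \<open>The outer edges are those that end at one of the new vertices; \<open>V\<close>
    names that vertex.\<close>
  have outer: "edge_integral X Y (\<lambda>x. g T x * v x) = 0"
    if "T \<in> {M, P, Q, R}" "T = convex hull {X, Y, Z}" "0 < orient X Y Z" "V \<in> {X, Y}" "V \<in> {A, B, C, D}"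
      "C1_with_gradient v G" for T X Y Z V v G
  proof -
    note new = that(5)
    have T: "convex hull {X, Y, Z} \<in> \<T>" using that(1) in_mesh unfolding that(2) by auto
    have "closed_segment X Y edge_of T"
      unfolding that(2) using that(3) by (subst edges_of_triangle) auto
    then have bd: "closed_segment X Y \<subseteq> frontier \<Omega> \<Longrightarrow>
        AE t in lebesgue. t \<in> {0..1} \<longrightarrow> g (convex hull {X, Y, Z}) (linepath X Y t) = 0"
      using boundary[OF that(1)] unfolding that(2) by blast
    show ?thesis
      unfolding that(2)
    proof (rule outer_flux[OF T that(3) bd _ _ support _ that(6)])
      show "finite ?S" by simp
      show "?S \<subseteq> \<T>" using in_mesh by simp
      fix U assume U: "convex hull {X, Y, U} \<in> ?S"
      \<comment> \<open>Each new vertex belongs to exactly one of the six triangles, so no other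
        triangle of the support can share an edge through it.\<close>
      have only: "T' = (if V = A then M else if V = B then P else if V = C then Q else R)"
        if T': "T' = convex hull {X', Y', Z'}" "T' \<in> ?S" "V \<in> {X', Y', Z'}" for T' X' Y' Z'
      proof -
        have m: "convex hull {X', Y', Z'} \<in> \<T>" using T' in_mesh by auto
        have "V \<in> {X1, Y1, Z1}" if "T' = convex hull {X1, Y1, Z1}" "convex hull {X1, Y1, Z1} \<in> \<T>" for X1 Y1 Z1
          using triangles_distinct[OF mesh m that(2) T'(3)] T'(1) that(1) by blast
        then have imp: "T' = K \<Longrightarrow> V \<in> {S, N, W}" "T' = L \<Longrightarrow> V \<in> {N, S, E}" "T' = M \<Longrightarrow> V \<in> {N, E, A}"
          "T' = P \<Longrightarrow> V \<in> {W, N, B}" "T' = Q \<Longrightarrow> V \<in> {S, W, C}" "T' = R \<Longrightarrow> V \<in> {E, S, D}"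
          using in_mesh unfolding defs(1-6) by blast+
        have "T' = K \<or> T' = L \<or> T' = M \<or> T' = P \<or> T' = Q \<or> T' = R"
          using T'(2) by blast
        moreover have "V = A \<or> V = B \<or> V = C \<or> V = D"
          using new by blast
        ultimately show ?thesis
          by (elim disjE) (use imp dist dist_rev in \<open>simp_all\<close>)
      qed
      have "convex hull {X, Y, U} = (if V = A then M else if V = B then P else if V = C then Q else R)"
        using only[OF refl U] that(4) by blast
      moreover have "convex hull {X, Y, Z} = (if V = A then M else if V = B then P else if V = C then Q else R)"
        using only[of "convex hull {X, Y, Z}" X Y Z] that(1,2,4) by blast
      ultimately show "convex hull {X, Y, U} = convex hull {X, Y, Z}" by simp
    qed
  qed

  \<comment> \<open>Green's formula on the six triangles\<close>
  obtain dK where dK: "AE x in lebesgue. x \<in> K \<longrightarrow> divergence \<Omega> ?q x = dK"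
    using div_const[OF in_mesh(1)] by blast
  obtain dL where dL: "AE x in lebesgue. x \<in> L \<longrightarrow> divergence \<Omega> ?q x = dL"
    using div_const[OF in_mesh(2)] by blast
  obtain dM where dM: "AE x in lebesgue. x \<in> M \<longrightarrow> divergence \<Omega> ?q x = dM"
    using div_const[OF in_mesh(3)] by blast
  obtain dP where dP: "AE x in lebesgue. x \<in> P \<longrightarrow> divergence \<Omega> ?q x = dP"
    using div_const[OF in_mesh(4)] by blast
  obtain dQ where dQ: "AE x in lebesgue. x \<in> Q \<longrightarrow> divergence \<Omega> ?q x = dQ"
    using div_const[OF in_mesh(5)] by blast
  obtain dR where dR: "AE x in lebesgue. x \<in> R \<longrightarrow> divergence \<Omega> ?q x = dR"
    using div_const[OF in_mesh(6)] by blast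
  note div_eq = dK dL dM dP dQ dR

  let ?I = "\<lambda>T G. integral T (\<lambda>x. G x \<bullet> ?q x)"
  \<comment> \<open>\<open>ef\<close>, \<open>fb\<close>, \<open>fc\<close> leave \<open>K\<close>,
    while \<open>fa\<close> and \<open>fd\<close> leave \<open>L\<close>. Each inner flux occurs
    with the opposite sign in the triangle across its edge, and the edges through new vertices
    contribute nothing.\<close>
  have green: "?I K G + dK * integral K v = ef + fb + fc"
    "?I L G + dL * integral L v = - ef + fd + fa"
    "?I M G + dM * integral M v = - fa"
    "?I P G + dP * integral P v = - fb"
    "?I Q G + dQ * integral Q v = - fc"
    "?I R G + dR * integral R v = - fd"
    if v: "C1_with_gradient v G"
      and f: "ef = edge_integral S N (\<lambda>x. g K x * v x)" "fa = edge_integral E N (\<lambda>x. g L x * v x)"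
        "fb = edge_integral N W (\<lambda>x. g K x * v x)" "fc = edge_integral W S (\<lambda>x. g K x * v x)"
        "fd = edge_integral S E (\<lambda>x. g L x * v x)" for v G ef fa fb fc fd
  proof -
    have "edge_integral N S (\<lambda>x. g L x * v x) = - ef" "edge_integral N E (\<lambda>x. g M x * v x) = - fa"
      "edge_integral W N (\<lambda>x. g P x * v x) = - fb" "edge_integral S W (\<lambda>x. g Q x * v x) = - fc"
      "edge_integral E S (\<lambda>x. g R x * v x) = - fd"
      using inner_flux[of S N W E v G] inner_flux[of E N S A v G] inner_flux[of N W S B v G]
        inner_flux[of W S N C v G] inner_flux[of S E N D v G] ins neq oK oL v
      unfolding f eqs by simp_all
    moreover have "edge_integral E A (\<lambda>x. g M x * v x) = 0" "edge_integral A N (\<lambda>x. g M x * v x) = 0"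
      "edge_integral N B (\<lambda>x. g P x * v x) = 0" "edge_integral B W (\<lambda>x. g P x * v x) = 0"
      "edge_integral W C (\<lambda>x. g Q x * v x) = 0" "edge_integral C S (\<lambda>x. g Q x * v x) = 0"
      "edge_integral S D (\<lambda>x. g R x * v x) = 0" "edge_integral D E (\<lambda>x. g R x * v x) = 0"
      using outer[OF _ M_eq(3)[symmetric] oM(2) _ _ v, of A] outer[OF _ M_eq(4)[symmetric] oM(3) _ _ v, of A]
        outer[OF _ P_eq(3)[symmetric] oP(2) _ _ v, of B] outer[OF _ P_eq(4)[symmetric] oP(3) _ _ v, of B]
        outer[OF _ Q_eq(3)[symmetric] oQ(2) _ _ v, of C] outer[OF _ Q_eq(4)[symmetric] oQ(3) _ _ v, of C]
        outer[OF _ R_eq(3)[symmetric] oR(2) _ _ v, of D] outer[OF _ R_eq(4)[symmetric] oR(3) _ _ v, of D]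
      by simp_all
    ultimately show "?I K G + dK * integral K v = ef + fb + fc"
      "?I L G + dL * integral L v = - ef + fd + fa"
      "?I M G + dM * integral M v = - fa"
      "?I P G + dP * integral P v = - fb"
      "?I Q G + dQ * integral Q v = - fc"
      "?I R G + dR * integral R v = - fd"
      using green_integral[OF ins(1) _ v, of dK] green_integral[OF ins(4) _ v, of dL]
        green_integral[OF M_in(1) _ v, of dM] green_integral[OF P_in(1) _ v, of dP]
        green_integral[OF Q_in(1) _ v, of dQ] green_integral[OF R_in(1) _ v, of dR] div_eq f
      unfolding eqs by simp_all
  qed

  \<comment> \<open>The test function 1 has zero gradient, which leaves the total divergence of each
    triangle.\<close>
  have area: "dK * measure lebesgue K = \<eta> + \<beta> + \<gamma>" "dL * measure lebesgue L = - \<eta> + \<delta> + \<alpha>"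
    "dM * measure lebesgue M = - \<alpha>" "dP * measure lebesgue P = - \<beta>"
    "dQ * measure lebesgue Q = - \<gamma>" "dR * measure lebesgue R = - \<delta>"
  proof -
    have "integral T (\<lambda>x. 1 :: real) = measure lebesgue T" if "T \<in> ?S" for T
      using that integral_unique[OF has_integral_const_triangle[where c = 1]] by (auto simp: defs(1-6))
    then show "dK * measure lebesgue K = \<eta> + \<beta> + \<gamma>" "dL * measure lebesgue L = - \<eta> + \<delta> + \<alpha>"
      "dM * measure lebesgue M = - \<alpha>" "dP * measure lebesgue P = - \<beta>"
      "dQ * measure lebesgue Q = - \<gamma>" "dR * measure lebesgue R = - \<delta>"
      using green[OF C1_with_gradient_const[of 1], of \<eta> \<alpha> \<beta> \<gamma> \<delta>] defs by simp_all
  qed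

  \<comment> \<open>Summing the six formulas cancels every flux against its opposite. The integrals
    against \<open>G\<close> combine to one over the whole domain since the field vanishes almost
    everywhere outside the six triangles.\<close>
  have balance: "?I \<Omega> G + (dK * integral K v + dL * integral L v + dM * integral M v + dP * integral P v +
      dQ * integral Q v + dR * integral R v) = 0" if v: "C1_with_gradient v G" for v G
  proof -
    let ?f = "\<lambda>x. G x \<bullet> ?q x"
    have f: "(?f has_integral ?I T G) T" if T: "T \<in> ?S" for T
    proof -
      obtain X Y Z where T: "T = convex hull {X, Y, Z}" "convex hull {X, Y, Z} \<in> \<T>"
        using T in_mesh unfolding defs(1-6) by auto
      have "(\<lambda>x. ?q x \<bullet> G x) absolutely_integrable_on T"
        unfolding T(1) by (intro absolutely_integrable_inner_continuous integrable_triangle T(2)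
          C1_with_gradient_continuous[OF v] compact_triangle)
      then show ?thesis
        by (simp add: inner_commute set_lebesgue_integral_eq_integral(1) integrable_integral)
    qed
    have "(?f has_integral (\<Sum>T\<in>?S. ?I T G)) (\<Union>?S)"
    proof (rule has_integral_Union)
      show "pairwise (\<lambda>S S'. negligible (S \<inter> S')) ?S"
        using mesh_inter_negligible[OF mesh] in_mesh unfolding pairwise_def by blast
    qed (use f in auto)
    moreover have "(\<Sum>T\<in>?S. ?I T G) = ?I K G + ?I L G + ?I M G + ?I P G + ?I Q G + ?I R G"
      using neq by (simp add: neq[symmetric])
    moreover have "integral (\<Union>?S) ?f = ?I \<Omega> G"
    proof (rule integral_spike_set)
      have "negligible (frontier \<Omega>)" using \<Omega> by (intro negligible_convex_frontier)
      moreover have "\<Union>?S \<subseteq> closure \<Omega>" using mesh_subset_closure[OF mesh] in_mesh by blast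
      ultimately show "negligible {x \<in> \<Union>?S - \<Omega>. ?f x \<noteq> 0}"
        using \<Omega>(1) by (elim negligible_subset) (auto simp: frontier_def interior_open)
      obtain N where "negligible N" "{x. \<not> (x \<in> \<Omega> \<longrightarrow> x \<notin> \<Union>?S \<longrightarrow> ?q x = 0)} \<subseteq> N"
        using support unfolding eventually_ae_filter_negligible by blast
      then show "negligible {x \<in> \<Omega> - \<Union>?S. ?f x \<noteq> 0}"
        by (elim negligible_subset) auto
    qed
    ultimately have "?I \<Omega> G = ?I K G + ?I L G + ?I M G + ?I P G + ?I Q G + ?I R G"
      by (simp add: integral_unique)
    then show ?thesis
      using green[OF v refl refl refl refl refl] by linarith
  qed

  \<comment> \<open>Of the expansion of \<open>F\<close>, duality retains the single coefficient of
    \<open>[S,N]\<close>.\<close>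
  have test: "?I \<Omega> F = dist S N * (?e \<bullet> F S)" if F: "\<And>x. F x = u + k *\<^sub>R x" for F u k
  proof -
    have "?I \<Omega> F = (\<Sum>b\<in>mesh_edges \<T>. edge_coefficient \<nu> F b * L2_inner \<Omega> (raviart_thomas \<T> \<nu> b) ?q)"
      by (rule L2_inner_affine[OF mesh orientation \<Omega> integrable_domain(1) F])
    also have "\<dots> = (\<Sum>b\<in>mesh_edges \<T>. if b = ?a then edge_coefficient \<nu> F b else 0)"
      using dual a_mesh unfolding dual_basis_hypothesis_def by (intro sum.cong) auto
    also have "\<dots> = edge_coefficient \<nu> F ?a"
      using a_mesh finite_mesh_edges[OF mesh] by simp
    finally show ?thesis
      using edge_coefficient_eq[OF orientation a_mesh F] by (simp add: orientation_SN)
  qed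

  \<comment> \<open>First identity, from constant fields\<close>
  have first: "\<eta> *\<^sub>R (L_c - K_c) + \<alpha> *\<^sub>R (M_c - L_c) + \<beta> *\<^sub>R (P_c - K_c) +
           \<gamma> *\<^sub>R (Q_c - K_c) + \<delta> *\<^sub>R (R_c - L_c) = dist S N *\<^sub>R ?e"
    (is "?lhs = _")
  proof -
    have "u \<bullet> ?lhs = u \<bullet> (dist S N *\<^sub>R ?e)" for u
    proof -
      \<comment> \<open>Once divergence times area is replaced by fluxes, each flux multiplies the
        difference of the barycentres on the two sides of its edge.\<close>
      have "?I \<Omega> (\<lambda>_. u) + (dK * (measure lebesgue K * (u \<bullet> K_c)) + dL * (measure lebesgue L * (u \<bullet> L_c)) +
          dM * (measure lebesgue M * (u \<bullet> M_c)) + dP * (measure lebesgue P * (u \<bullet> P_c)) +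
          dQ * (measure lebesgue Q * (u \<bullet> Q_c)) + dR * (measure lebesgue R * (u \<bullet> R_c))) = 0"
        using balance[OF C1_with_gradient_affine[of 0 u]] integral_triangle_linear[OF nz(1), of u]
          integral_triangle_linear[OF nz(4), of u] integral_triangle_linear[OF mesh_simplexD[OF mesh M_in(1)], of u]
          integral_triangle_linear[OF mesh_simplexD[OF mesh P_in(1)], of u]
          integral_triangle_linear[OF mesh_simplexD[OF mesh Q_in(1)], of u]
          integral_triangle_linear[OF mesh_simplexD[OF mesh R_in(1)], of u]
        unfolding eqs defs(7-12) by simp
      moreover have "?I \<Omega> (\<lambda>_. u) = dist S N * (?e \<bullet> u)"
        using test[of "\<lambda>_. u" u 0] by simp
      ultimately show ?thesis
        unfolding mult.assoc[symmetric] area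
        by (simp add: inner_add_right inner_diff_right inner_commute[of u ?e] algebra_simps)
    qed
    then show ?thesis using vector_eq_rdot by (metis inner_commute)
  qed

  \<comment> \<open>Second identity, from the field centred at the midpoint\<close>
  define n w e a b c d where "n = N - mid" and "w = W - mid" and "e = E - mid" and "a = A - mid"
    and "b = B - mid" and "c = C - mid" and "d = D - mid"
  have S': "S - mid = - n"
    by (simp add: n_def defs(13) midpoint_def vec_eq_iff field_simps)
  \<comment> \<open>The vector from the midpoint to \<open>S\<close> is parallel to the edge, so the
    centred field has no flux through it and the quadratic test has right-hand side 0.\<close>
  have "?e \<bullet> (S - mid) = 0"
  proof -
    have "dist S N * (?e \<bullet> (N - S)) = 0"
      unfolding edge_normal_orient[OF \<open>S \<noteq> N\<close>] by simp
    moreover have "S - mid = (-1/2) *\<^sub>R (N - S)"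
      by (simp add: defs(13) midpoint_def vec_eq_iff field_simps)
    ultimately show ?thesis using \<open>S \<noteq> N\<close> by simp
  qed
  then have "?I \<Omega> (\<lambda>x. x - mid) = 0"
    using test[of "\<lambda>x. x - mid" "- mid" 1] by simp
  note test_quadratic = this
  have diffs: "L_c - K_c = (1/3) *\<^sub>R (e - w)" "M_c - L_c = (1/3) *\<^sub>R (a + n)"
    "P_c - K_c = (1/3) *\<^sub>R (b + n)" "Q_c - K_c = (1/3) *\<^sub>R (c - n)" "R_c - L_c = (1/3) *\<^sub>R (d - n)"
    "(L_c - mid) + (K_c - mid) = (1/3) *\<^sub>R (e + w)"
    unfolding defs(7-13) barycentre_def n_def w_def e_def a_def b_def c_def d_def midpoint_def
    by (simp_all add: vec_eq_iff field_simps)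
  have vertex_diffs: "A - W = a - w" "B - E = b - e" "C - E = c - e" "D - W = d - w"
    by (simp_all add: w_def e_def a_def b_def c_def d_def)
  \<comment> \<open>The 24 is the 12 of the second moment times the 2 from the factor 1/2 of the
    potential.\<close>
  have moment: "integral (convex hull {X, Y, Z}) (\<lambda>x. (1/2) * ((x - mid) \<bullet> (x - mid))) =
      measure lebesgue (convex hull {X, Y, Z}) * (((X - mid) \<bullet> (X - mid) + (Y - mid) \<bullet> (Y - mid) +
        (Z - mid) \<bullet> (Z - mid) + ((X - mid) + (Y - mid) + (Z - mid)) \<bullet> ((X - mid) + (Y - mid) + (Z - mid))) / 24)"
    if "convex hull {X, Y, Z} \<in> \<T>" for X Y Z
  proof -
    have "X + Y + Z - 3 *\<^sub>R mid = (X - mid) + (Y - mid) + (Z - mid)"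
      by (simp add: vec_eq_iff)
    then show ?thesis
      using integral_triangle_quadratic[OF mesh_simplexD[OF mesh that], of mid]
      by (simp only:) simp
  qed
  have second: "(\<eta> + \<beta> + \<gamma>) * (n \<bullet> n + n \<bullet> n + w \<bullet> w + w \<bullet> w) +
      (- \<eta> + \<delta> + \<alpha>) * (n \<bullet> n + n \<bullet> n + e \<bullet> e + e \<bullet> e) -
      \<alpha> * (n \<bullet> n + e \<bullet> e + a \<bullet> a + (n + e + a) \<bullet> (n + e + a)) -
      \<beta> * (w \<bullet> w + n \<bullet> n + b \<bullet> b + (w + n + b) \<bullet> (w + n + b)) -
      \<gamma> * (n \<bullet> n + w \<bullet> w + c \<bullet> c + (w + c - n) \<bullet> (w + c - n)) -
      \<delta> * (e \<bullet> e + n \<bullet> n + d \<bullet> d + (e + d - n) \<bullet> (e + d - n)) = 0"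
  proof -
    \<comment> \<open>In \<open>K\<close> and \<open>L\<close> the vectors of \<open>S\<close> and
      \<open>N\<close> cancel in the vertex sum, which leaves \<open>w\<close> or \<open>e\<close>
      alone; hence the repeated squares in the first two terms.\<close>
    have "dK * (measure lebesgue K * ((n \<bullet> n + n \<bullet> n + w \<bullet> w + w \<bullet> w) / 24)) +
      dL * (measure lebesgue L * ((n \<bullet> n + n \<bullet> n + e \<bullet> e + e \<bullet> e) / 24)) +
      dM * (measure lebesgue M * ((n \<bullet> n + e \<bullet> e + a \<bullet> a + (n + e + a) \<bullet> (n + e + a)) / 24)) +
      dP * (measure lebesgue P * ((w \<bullet> w + n \<bullet> n + b \<bullet> b + (w + n + b) \<bullet> (w + n + b)) / 24)) +
      dQ * (measure lebesgue Q * ((n \<bullet> n + w \<bullet> w + c \<bullet> c + (- n + w + c) \<bullet> (- n + w + c)) / 24)) +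
      dR * (measure lebesgue R * ((e \<bullet> e + n \<bullet> n + d \<bullet> d + (e + - n + d) \<bullet> (e + - n + d)) / 24)) = 0"
      using balance[OF C1_with_gradient_quadratic[of mid]]
      unfolding moment[OF K_in(1), unfolded K_eq] moment[OF L_in(1), unfolded L_eq] moment[OF M_in(1), unfolded M_eq]
        moment[OF P_in(1), unfolded P_eq] moment[OF Q_in(1), unfolded Q_eq] moment[OF R_in(1), unfolded R_eq]
        test_quadratic S' n_def[symmetric] w_def[symmetric] e_def[symmetric] a_def[symmetric]
        b_def[symmetric] c_def[symmetric] d_def[symmetric]
      by simp
    then show ?thesis
      unfolding mult.assoc[symmetric] area by (simp add: algebra_simps inner_commute add_divide_distrib diff_divide_distrib)
  qed
  \<comment> \<open>The factor 3 of the claim compensates the 1/3 in the sum of the two barycentres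
    taken from the midpoint.\<close>
  show ?thesis
    using first flux_algebra[OF first[unfolded diffs] second]
    unfolding diffs vertex_diffs by simp
qed

end
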